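(* Let $0\le a_0<a_1<\cdots<a_N$ and let $M$ be a regular sequence with $\sum_n M_n/M_{n+1}=\infty$. Then the Laplace transform $$\mathcal{L}:\ \tau_{a_0}A(M,\Gamma;[0,1))\oplus\cdots\oplus\tau_{a_N}A(M,\Gamma;[0,1))\ \longrightarrow\ e^{-a_0/x}D(M,\Gamma;[0,1))\oplus\cdots\oplus e^{-a_N/x}D(M,\Gamma;[0,1))$$ is a bijection (in particular, both sums of function spaces are direct).
   Context: A positive sequence $M=(n!\,m_n)_{n\ge0}$ is regular if (1) $m_n^2\le m_{n-1}m_{n+1}$ for all sufficiently large $n$; (2) $(m_n^{1/n})$ is eventually non-decreasing; (3) there is $C>0$ with $m_{n+1}\le Cm_n^{1+1/n}$ for all $n\ge1$. $A(M,\Gamma;[0,1))$ is the set of $F\in C^\infty[0,\infty)$ such that for every $\eta>1$ there is $C>0$ with $|F^{(n)}(x)|\le C^{n+1}M_ne^{\eta x}$ for all $x\ge0$, $n\ge0$. $\Omega_\eta=\{z\ne0:\sup_{t>0}e^{t\eta}|e^{-t/z}|<\infty\}=\{z\neq 0:\operatorname{Re}(1/z)\ge\eta\}$. $D(M,\Gamma;[0,1))$ is the set of functions $f$ such that for every $\eta>1$, $f\in\mathrm{Hol}(\Omega_\eta)\cap C^\infty(\{0\}\cup\Omega_\eta)$ (all derivatives extend continuously to $0$ from $\Omega_\eta$) and there is $C=C_\eta>0$ with $$\Big|f(z)-\sum_{0\le k<n}\frac{f^{(k)}(0)}{k!}z^k\Big|\le C^{n+1}M_n|z|^n\qquad\text{for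 all }n\ge0,\ z\in\Omega_\eta.$$ For $a\ge0$, $(\tau_aF)(x)=F(x-a)$ for $x\ge a$ and $0$ for $0\le x<a$. The Laplace transform is $(\mathcal{L}F)(x)=\frac1x\int_0^\infty F(t)e^{-t/x}\,dt$ (equivalently $\int_0^\infty F(xt)e^{-t}dt$). $e^{-a/x}D$ denotes the set of functions $x\mapsto e^{-a/x}f(x)$, $f\in D$. *)

theory Defs
  imports "HOL-Complex_Analysis.Complex_Analysis"
begin

definition regular_seq :: "(nat \<Rightarrow> real) \<Rightarrow> bool" where
  "regular_seq M \<longleftrightarrow>
     (\<forall>n. 0 < M n) \<and>
     (let m = (\<lambda>n. M n / fact n) in
        (\<forall>\<^sub>F n in sequentially. (m n)\<^sup>2 \<le> m (n - 1) * m (n + 1)) \<and>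
        (\<forall>\<^sub>F n in sequentially. root n (m n) \<le> root (n + 1) (m (n + 1))) \<and>
        (\<exists>C>0. \<forall>n\<ge>1. m (n + 1) \<le> C * m n powr (1 + 1 / real n)))"

text \<open>
  Functions on the half-line are represented by total functions vanishing on the negative reals,
  so that equality of representatives is equality on the half-line. All derivatives are taken
  relative to the half-line, hence one-sided at the origin.
\<close>

definition deriv_half :: "nat \<Rightarrow> (real \<Rightarrow> complex) \<Rightarrow> real \<Rightarrow> complex" where
  "deriv_half n F = ((\<lambda>G x. vector_derivative G (at x within {0..})) ^^ n) F"

definition smooth_half :: "(real \<Rightarrow> complex) \<Rightarrow> bool" where
  "smooth_half F \<longleftrightarrow> (\<forall>n. \<forall>x\<ge>0. deriv_half n F differentiable (at x within {0..}))"

definition A_class :: "(nat \<Rightarrow> real) \<Rightarrow> (real \<Rightarrow> complex) set" where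
  "A_class M = {F. smooth_half F \<and> (\<forall>x<0. F x = 0) \<and>
     (\<forall>\<eta>>1. \<exists>C>0. \<forall>n. \<forall>x\<ge>0. norm (deriv_half n F x) \<le> C ^ (n + 1) * M n * exp (\<eta> * x))}"

definition Omega :: "real \<Rightarrow> complex set" where
  "Omega \<eta> = {z. z \<noteq> 0 \<and> Re (1 / z) \<ge> \<eta>}"

lemma Omega_eq_bdd:
  "Omega \<eta> = {z. z \<noteq> 0 \<and> bdd_above ((\<lambda>t. exp (t * \<eta>) * norm (exp (- of_real t / z))) ` {0<..})}"
proof -
  have eq: "exp (t * \<eta>) * norm (exp (- of_real t / z)) = exp (t * (\<eta> - Re (1 / z)))" for t z
  proof -
    have "Re (- of_real t / z) = - t * Re (1 / z)"
      by (simp add: Re_divide)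
    then show ?thesis
      by (simp add: exp_add [symmetric] algebra_simps)
  qed
  have "bdd_above ((\<lambda>t. exp (t * (\<eta> - r))) ` {0<..}) \<longleftrightarrow> r \<ge> \<eta>" for r :: real
  proof
    assume "bdd_above ((\<lambda>t. exp (t * (\<eta> - r))) ` {0<..})"
    then obtain B where B: "\<And>t. t > 0 \<Longrightarrow> exp (t * (\<eta> - r)) \<le> B"
      by (auto simp: bdd_above_def)
    show "r \<ge> \<eta>"
    proof (rule ccontr)
      assume "\<not> r \<ge> \<eta>"
      then have pos: "\<eta> - r > 0" by simp
      define t where "t = (\<bar>B\<bar> + 1) / (\<eta> - r)"
      have "t > 0" using pos by (simp add: t_def)
      have "t * (\<eta> - r) = \<bar>B\<bar> + 1" using pos by (simp add: t_def)
      with B [OF \<open>t > 0\<close>] have "exp (\<bar>B\<bar> + 1) \<le> B" by simp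
      with exp_ge_add_one_self [of "\<bar>B\<bar> + 1"] show False by linarith
    qed
  next
    assume "r \<ge> \<eta>"
    then show "bdd_above ((\<lambda>t. exp (t * (\<eta> - r))) ` {0<..})"
      by (auto intro!: bdd_aboveI2 [of _ _ 1] simp: mult_le_0_iff)
  qed
  then show ?thesis
    by (simp only: Omega_def eq)
qed

definition Omega_all :: "complex set" where
  "Omega_all = (\<Union>\<eta>\<in>{1<..}. Omega \<eta>)"

text \<open>
  Elements of the class below live on \<open>Omega_all\<close>, the common domain of all the conditions, and
  are represented by total functions vanishing elsewhere. The point 0 is not in the domain:
  \<open>c k\<close> is the continuous extension to 0 of the \<open>k\<close>-th derivative, which
  plays the role of the \<open>k\<close>-th derivative at 0 (for \<open>k = 0\<close>, the value at 0). As \<open>Omega_all\<close> is open, \<open>deriv\<close> is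
  the usual complex derivative at every point of every \<open>Omega \<eta>\<close> with \<open>\<eta> > 1\<close>.
\<close>

definition D_class :: "(nat \<Rightarrow> real) \<Rightarrow> (complex \<Rightarrow> complex) set" where
  "D_class M = {f. (\<forall>z. z \<notin> Omega_all \<longrightarrow> f z = 0) \<and>
     (\<forall>\<eta>>1. f holomorphic_on Omega \<eta> \<and>
        (\<exists>c. (\<forall>k. (((deriv ^^ k) f) \<longlongrightarrow> c k) (at 0 within Omega \<eta>)) \<and>
             (\<exists>C>0. \<forall>n. \<forall>z\<in>Omega \<eta>.
                norm (f z - (\<Sum>k<n. c k / fact k * z ^ k)) \<le> C ^ (n + 1) * M n * norm z ^ n)))}"

definition tau :: "real \<Rightarrow> (real \<Rightarrow> complex) \<Rightarrow> real \<Rightarrow> complex" where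
  "tau a F x = (if x \<ge> a then F (x - a) else 0)"

definition exp_mult :: "real \<Rightarrow> (complex \<Rightarrow> complex) \<Rightarrow> complex \<Rightarrow> complex" where
  "exp_mult a f z = exp (- of_real a / z) * f z"

definition laplace :: "(real \<Rightarrow> complex) \<Rightarrow> complex \<Rightarrow> complex" where
  "laplace F z =
     (if z \<in> Omega_all then 1 / z * (LINT t:{0..}|lborel. F t * exp (- of_real t / z)) else 0)"

definition sum_spaces :: "nat \<Rightarrow> (nat \<Rightarrow> ('a \<Rightarrow> complex) set) \<Rightarrow> ('a \<Rightarrow> complex) set" where
  "sum_spaces N V = {(\<lambda>x. \<Sum>j\<le>N. v j x) | v. \<forall>j\<le>N. v j \<in> V j}"

definition sum_is_direct :: "nat \<Rightarrow> (nat \<Rightarrow> ('a \<Rightarrow> complex) set) \<Rightarrow> bool" where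
  "sum_is_direct N V \<longleftrightarrow>
     (\<forall>v w. (\<forall>j\<le>N. v j \<in> V j \<and> w j \<in> V j) \<and> (\<lambda>x. \<Sum>j\<le>N. v j x) = (\<lambda>x. \<Sum>j\<le>N. w j x)
        \<longrightarrow> (\<forall>j\<le>N. v j = w j))"

end

theory Submission
  imports Defs
begin

text \<open>
  Write \<open>w = 1 / z\<close>, so that the transform of \<open>F\<close> at \<open>z\<close> is \<open>w\<close> times the integral
  \<open>half_laplace F w\<close> of \<open>F t * exp (- t w)\<close>. The transform of a translate by \<open>a\<close> is the
  transform multiplied by \<open>exp (- a w)\<close>, so the theorem rests on two facts.

  The first is that the transform maps \<open>A_class M\<close> onto \<open>D_class M\<close>
  (\<open>laplace_image_A_class\<close>). Repeated integration by parts expands the transform of \<open>F\<close> in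
  powers of \<open>z\<close>, with coefficients the derivatives of \<open>F\<close> at 0 and a remainder that is the
  transform of a derivative of \<open>F\<close>. The derivatives of the transform then have limits at 0 by
  Cauchy's estimates on discs of radius comparable to \<open>norm z\<close> squared. Conversely, let \<open>f\<close> have
  expansion \<open>\<Sum>k. b k * z ^ k\<close>. In the coordinate \<open>z\<close> the half-plane \<open>\<eta> \<le> Re w\<close> is a
  disc with the origin on its boundary, and Bromwich's integral becomes an integral over the
  boundary circle. It converges absolutely once \<open>b 0 + b 1 * z\<close> has been subtracted. Doing this
  for every shifted function \<open>g k z = (f z - (\<Sum>j<k. b j * z ^ j)) / z ^ k\<close> gives continuous
  functions \<open>H k\<close> with transforms \<open>g k\<close>. As \<open>g k z = b k + z * g (Suc k) z\<close>, uniqueness of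
  the transform shows that \<open>H (Suc k)\<close> is the derivative of \<open>H k\<close>, so the bound on \<open>H k\<close> is
  a bound on the \<open>k\<close>-th derivative of \<open>H 0\<close>. Loss of a bounded number of indices in \<open>M\<close> costs
  only a geometric factor, by regularity.

  The second is that \<open>\<Sum>j. exp (- a j w) * half_laplace (F j) w = 0\<close> forces every \<open>F j\<close> to
  vanish (\<open>A_class_laplace_sum_zero\<close>). If \<open>F i = 0\<close> for \<open>i < j\<close>, the equation says that
  \<open>half_laplace (F j) w\<close> is of size \<open>exp (- d * Re w)\<close> with \<open>d = a (j + 1) - a j\<close>. By
  Liouville's theorem \<open>F j\<close> vanishes on \<open>[0, d)\<close>, and by the Denjoy--Carleman theorem, which is
  where the divergence of \<open>\<Sum>n. M n / M (n + 1)\<close> enters, it vanishes everywhere.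

  Applied to differences, the second fact gives injectivity of the transform on the sum of the
  translated classes and the directness of that sum; combined with the first it gives
  directness of the sum of the spaces \<open>exp (- a j / z) D\<close>.
\<close>

section \<open>Regular weight sequences\<close>

lemma regular_seq_pos: "regular_seq M \<Longrightarrow> 0 < M n"
  by (simp add: regular_seq_def)

text \<open>
  With \<open>m n = M n / fact n\<close>, the third regularity condition bounds \<open>m (n + 1) / m n\<close> by a multiple
  of the \<open>n\<close>-th root of \<open>m n\<close>. The crude induction \<open>m n \<le> D ^ (n * n)\<close> shows that this root
  is at most geometric. This is what absorbs a shift of the index in every later estimate.
\<close>

lemma regular_seq_derivation_closed:
  assumes "regular_seq M"
  obtains B where "B \<ge> 1" "\<And>n. M (Suc n) \<le> B ^ Suc n * M n"
proof -
  define m where "m = (\<lambda>n. M n / fact n)"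
  have pos: "0 < M n" for n
    using assms by (rule regular_seq_pos)
  then have mpos: "0 < m n" for n
    by (simp add: m_def)
  obtain C where C: "C > 0" "\<And>n. n \<ge> 1 \<Longrightarrow> m (n + 1) \<le> C * m n powr (1 + 1 / real n)"
    using assms unfolding regular_seq_def Let_def m_def by blast
  \<comment> \<open>\<open>D \<ge> m 1\<close> starts the induction below and \<open>D \<ge> C\<close> carries it on,
    as \<open>1 + n * n + n \<le> (n + 1) * (n + 1)\<close>.\<close>
  define D where "D = Max {1, C, m 1}"
  have D: "1 \<le> D" "C \<le> D" "m 1 \<le> D"
    by (simp_all add: D_def)
  have root_bound: "m n powr (1 / real n) \<le> D ^ n" if "m n \<le> D ^ (n * n)" "n \<ge> 1" for n
  proof -
    have "m n powr (1 / real n) \<le> (D ^ (n * n)) powr (1 / real n)"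
      using that mpos[of n] by (intro powr_mono2) auto
    also have "\<dots> = D powr (real (n * n) * (1 / real n))"
      using D(1) by (subst powr_realpow [symmetric]) (simp_all add: powr_powr)
    also have "real (n * n) * (1 / real n) = real n"
      using that by simp
    also have "D powr real n = D ^ n"
      using D(1) by (simp add: powr_realpow)
    finally show ?thesis .
  qed
  have step: "m (n + 1) \<le> C * (m n * D ^ n)" if "m n \<le> D ^ (n * n)" "n \<ge> 1" for n
  proof -
    have "m (n + 1) \<le> C * m n powr (1 + 1 / real n)"
      using C(2) that by blast
    also have "\<dots> = C * (m n * m n powr (1 / real n))"
      using mpos[of n] by (simp add: powr_add)
    also have "\<dots> \<le> C * (m n * D ^ n)"
      using root_bound[OF that] mpos[of n] C(1) by (intro mult_left_mono) auto
    finally show ?thesis .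
  qed
  have m_bound: "m n \<le> D ^ (n * n)" if "n \<ge> 1" for n
    using that
  proof (induction n rule: dec_induct)
    case base
    then show ?case using D by simp
  next
    case (step n)
    have "m (n + 1) \<le> C * (m n * D ^ n)"
      using step \<open>\<And>n. m n \<le> D ^ (n * n) \<Longrightarrow> 1 \<le> n \<Longrightarrow> m (n + 1) \<le> C * (m n * D ^ n)\<close> by auto
    also have "\<dots> \<le> D * (D ^ (n * n) * D ^ n)"
      using step D C mpos[of n] by (intro mult_mono) auto
    also have "\<dots> = D ^ (1 + n * n + n)"
      by (simp add: power_add)
    also have "\<dots> \<le> D ^ (Suc n * Suc n)"
      using D by (intro power_increasing) auto
    finally show ?case by simp
  qed
  define B where "B = Max {1, M 1 / M 0, 2 * C, 2 * D}"
  have B: "1 \<le> B" "M 1 / M 0 \<le> B" "2 * C \<le> B" "2 * D \<le> B"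
    by (simp_all add: B_def)
  have "M (Suc n) \<le> B ^ Suc n * M n" for n
  proof (cases "n = 0")
    case True
    then show ?thesis using B(2) pos[of 0] by (simp add: field_simps)
  next
    case False
    then have n: "n \<ge> 1" by simp
    have "M (Suc n) = fact (Suc n) * m (n + 1)"
      by (simp add: m_def)
    also have "\<dots> \<le> fact (Suc n) * (C * (m n * D ^ n))"
      using step[OF m_bound n] n by (intro mult_left_mono) auto
    also have "\<dots> = real (Suc n) * (C * D ^ n) * M n"
      by (simp add: m_def field_simps)
    also have "\<dots> \<le> (2 ^ Suc n * (C * D ^ n)) * M n"
      using C D pos[of n] of_nat_less_two_power[of "Suc n", where 'a = real]
      by (intro mult_right_mono) auto
    also have "2 ^ Suc n * (C * D ^ n) = (2 * C) * (2 * D) ^ n"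
      by (simp add: power_mult_distrib)
    also have "\<dots> * M n \<le> (B * B ^ n) * M n"
      using B C D pos[of n] by (intro mult_right_mono mult_mono power_mono) auto
    finally show ?thesis by simp
  qed
  with B(1) show ?thesis using that by blast
qed

text \<open>
  Passing from \<open>m\<close> to \<open>M\<close> only helps, because the factorial is itself log-convex.
\<close>

lemma regular_seq_eventually_log_convex:
  assumes "regular_seq M"
  shows "\<forall>\<^sub>F n in sequentially. (M (Suc n))\<^sup>2 \<le> M n * M (Suc (Suc n))"
proof -
  define m where "m = (\<lambda>n. M n / fact n)"
  have pos: "0 < m n" for n
    using regular_seq_pos[OF assms] by (simp add: m_def)
  have M: "M n = fact n * m n" for n
    by (simp add: m_def)
  have "\<forall>\<^sub>F n in sequentially. (m n)\<^sup>2 \<le> m (n - 1) * m (n + 1)"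
    using assms by (simp add: regular_seq_def Let_def m_def)
  then have "\<forall>\<^sub>F n in sequentially. (m (Suc n))\<^sup>2 \<le> m (Suc n - 1) * m (Suc n + 1)"
    by (rule eventually_compose_filterlim) (rule filterlim_Suc)
  then show ?thesis
  proof eventually_elim
    case (elim n)
    have "(M (Suc n))\<^sup>2 = (real (Suc n) * fact n * fact (Suc n)) * (m (Suc n))\<^sup>2"
      by (simp add: M power2_eq_square algebra_simps)
    also have "\<dots> \<le> (real (Suc (Suc n)) * fact n * fact (Suc n)) * (m n * m (Suc (Suc n)))"
      using elim by (intro mult_mono) auto
    also have "\<dots> = M n * M (Suc (Suc n))"
      by (simp add: M algebra_simps)
    finally show ?case .
  qed
qed

section \<open>Quasianalyticity on the half-line\<close>

lemma log_convex_ratio_mono: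
  fixes Q :: "nat \<Rightarrow> real"
  assumes "\<And>n. 0 < Q n" "\<And>n. (Q (Suc n))\<^sup>2 \<le> Q n * Q (Suc (Suc n))"
  shows "mono (\<lambda>n. Q (Suc n) / Q n)"
  unfolding mono_iff_le_Suc using assms
  by (simp add: field_simps power2_eq_square)

text \<open>
  Bang's method measures flatness at \<open>x\<close> by the largest \<open>k\<close> such that
  \<open>norm (g n x) \<le> exp (n - k) * Q n\<close> for all \<open>n\<close>. Derivatives of order at least \<open>k\<close> satisfy
  this automatically, so only finitely many orders matter, and log-convexity bounds the ratios
  \<open>Q (n + 1) / Q n\<close> for those by the last one. Hence the flatness drops by at most
  one, from \<open>k + 1\<close> to \<open>k\<close>, over a distance of \<open>Q k / (e * Q (k + 1))\<close>.
\<close>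

lemma Bang_step:
  fixes g :: "nat \<Rightarrow> real \<Rightarrow> complex" and Q :: "nat \<Rightarrow> real"
  assumes deriv: "\<And>n x. 0 \<le> x \<Longrightarrow> (g n has_vector_derivative g (Suc n) x) (at x within {0..})"
    and Q: "\<And>n. 0 < Q n" "\<And>n. (Q (Suc n))\<^sup>2 \<le> Q n * Q (Suc (Suc n))"
    and bound: "\<And>n x. 0 \<le> x \<Longrightarrow> x \<le> T \<Longrightarrow> norm (g n x) \<le> Q n"
    and start: "\<And>n. norm (g n x) \<le> exp (real n - real (Suc N)) * Q n"
    and x: "0 \<le> x" and s: "0 \<le> s" "s \<le> Q N / (exp 1 * Q (Suc N))" "x + s \<le> T"
  shows "norm (g n (x + s)) \<le> exp (real n - real N) * Q n"
proof (cases "n \<le> Suc N")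
  case False
  have "norm (g n (x + s)) \<le> 1 * Q n"
    using bound[of "x + s" n] x s by simp
  also have "\<dots> \<le> exp (real n - real N) * Q n"
    using False Q(1)[of n] by (intro mult_right_mono) auto
  finally show ?thesis .
next
  case True
  define \<rho> where "\<rho> = exp 1 * (Q (Suc N) / Q N)"
  have \<rho>: "\<rho> > 0" using Q by (simp add: \<rho>_def)
  have ratio: "Q (Suc n) * exp 1 \<le> \<rho> * Q n" if "n \<le> N" for n
    using monoD[OF log_convex_ratio_mono[of Q, OF Q] that] Q(1)[of n] Q(1)[of N]
    by (simp add: \<rho>_def field_simps)
  \<comment> \<open>Downward induction on the order of differentiation: a bound of this shape for
    the next derivative integrates to the same bound for the derivative itself.\<close>
  have "\<forall>u\<in>{0..s}. norm (g n (x + u)) \<le> exp (real n - real (Suc N)) * Q n * exp (\<rho> * u)"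
    using True
  proof (induction n rule: inc_induct)
    case base
    show ?case
    proof
      fix u assume u: "u \<in> {0..s}"
      have "norm (g (Suc N) (x + u)) \<le> Q (Suc N) * 1"
        using bound[of "x + u" "Suc N"] x s u by simp
      also have "\<dots> \<le> Q (Suc N) * exp (\<rho> * u)"
        using u \<rho> Q(1)[of "Suc N"] by (intro mult_left_mono) auto
      finally show "norm (g (Suc N) (x + u)) \<le> exp (real (Suc N) - real (Suc N)) * Q (Suc N) * exp (\<rho> * u)"
        by simp
    qed
  next
    case (step n)
    define c where "c = exp (real n - real (Suc N)) * Q n"
    show ?case
    proof
      fix u assume u: "u \<in> {0..s}"
      show "norm (g n (x + u)) \<le> exp (real n - real (Suc N)) * Q n * exp (\<rho> * u)"
      proof (cases "u = 0")
        case True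
        then show ?thesis using start[of n] by simp
      next
        case False
        have gder: "((\<lambda>v. g n (x + v)) has_vector_derivative g (Suc n) (x + v)) (at v within {0..})"
          if "v \<ge> 0" for v
        proof -
          have "((g n \<circ> (\<lambda>v. x + v)) has_vector_derivative 1 *\<^sub>R g (Suc n) (x + v)) (at v within {0..})"
          proof (rule vector_diff_chain_within)
            show "((+) x has_vector_derivative 1) (at v within {0..})"
              by (auto intro!: derivative_eq_intros)
            show "(g n has_vector_derivative g (Suc n) (x + v)) (at (x + v) within (+) x ` {0..})"
              using deriv[of "x + v" n] x that by (auto intro: has_vector_derivative_within_subset)
          qed
          then show ?thesis by (simp add: o_def)
        qed
        have "norm (g n (x + u) - g n (x + 0)) \<le> c * exp (\<rho> * u) - c * exp (\<rho> * 0)"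
        proof (rule differentiable_bound_general[where f = "\<lambda>v. g n (x + v)" and f' = "\<lambda>v. g (Suc n) (x + v)"
              and \<phi> = "\<lambda>v. c * exp (\<rho> * v)" and \<phi>' = "\<lambda>v. c * \<rho> * exp (\<rho> * v)"])
          show "0 < u" using u False by simp
          show "continuous_on {0..u} (\<lambda>v. g n (x + v))"
            by (rule continuous_on_vector_derivative, rule has_vector_derivative_within_subset[OF gder]) auto
          show "continuous_on {0..u} (\<lambda>v. c * exp (\<rho> * v))"
            by (intro continuous_intros)
          fix v assume v: "0 < v" "v < u"
          show "((\<lambda>v. g n (x + v)) has_vector_derivative g (Suc n) (x + v)) (at v)"
            using gder[of v] v at_within_interior[of v "{0..}"] by simp
          show "((\<lambda>v. c * exp (\<rho> * v)) has_vector_derivative c * \<rho> * exp (\<rho> * v)) (at v)"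
            unfolding has_real_derivative_iff_has_vector_derivative[symmetric]
            by (auto intro!: derivative_eq_intros)
          have "norm (g (Suc n) (x + v)) \<le> exp (real (Suc n) - real (Suc N)) * Q (Suc n) * exp (\<rho> * v)"
            using step.IH v u by auto
          also have "\<dots> = exp (real n - real (Suc N)) * (Q (Suc n) * exp 1) * exp (\<rho> * v)"
            using exp_add[of "real n - real (Suc N)" 1] by (simp add: algebra_simps)
          also have "\<dots> \<le> exp (real n - real (Suc N)) * (\<rho> * Q n) * exp (\<rho> * v)"
            using ratio[of n] step.hyps by (intro mult_right_mono mult_left_mono) auto
          finally show "norm (g (Suc n) (x + v)) \<le> c * \<rho> * exp (\<rho> * v)"
            by (simp add: c_def mult_ac)
        qed
        then have "norm (g n (x + u)) \<le> norm (g n x) + (c * exp (\<rho> * u) - c)"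
          using norm_triangle_sub[of "g n (x + u)" "g n x"] by simp
        also have "\<dots> \<le> c * exp (\<rho> * u)"
          using start[of n] by (simp add: c_def)
        finally show ?thesis by (simp add: c_def)
      qed
    qed
  qed
  then have "norm (g n (x + s)) \<le> exp (real n - real (Suc N)) * Q n * exp (\<rho> * s)"
    using s by auto
  also have "\<dots> \<le> exp (real n - real (Suc N)) * Q n * exp 1"
    using s Q(1)[of n] Q(1)[of N] Q(1)[of "Suc N"]
    by (intro mult_left_mono) (auto simp: \<rho>_def field_simps)
  also have "\<dots> = exp (real n - real N) * Q n"
    by (simp add: exp_diff exp_add field_simps)
  finally show ?thesis .
qed

text \<open>
  Infinite flatness at 0 allows any starting level \<open>N\<close>; descending from \<open>N\<close> to \<open>k\<close> covers a
  distance equal to the sum of the individual steps.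
\<close>

lemma Bang_steps:
  fixes g :: "nat \<Rightarrow> real \<Rightarrow> complex" and Q :: "nat \<Rightarrow> real"
  assumes deriv: "\<And>n x. 0 \<le> x \<Longrightarrow> (g n has_vector_derivative g (Suc n) x) (at x within {0..})"
    and Q: "\<And>n. 0 < Q n" "\<And>n. (Q (Suc n))\<^sup>2 \<le> Q n * Q (Suc (Suc n))"
    and bound: "\<And>n x. 0 \<le> x \<Longrightarrow> x \<le> T \<Longrightarrow> norm (g n x) \<le> Q n"
    and flat: "\<And>n. g n 0 = 0"
    and x: "0 \<le> x" "x \<le> T" "x \<le> (\<Sum>j\<in>{k..<N}. Q j / (exp 1 * Q (Suc j)))" and "k \<le> N"
  shows "norm (g n x) \<le> exp (real n - real k) * Q n"
  using \<open>k \<le> N\<close> x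
proof (induction k arbitrary: x n rule: inc_induct)
  case base
  then have "x = 0" by simp
  then show ?case using flat[of n] Q(1)[of n] by simp
next
  case (step k)
  define h where "h = Q k / (exp 1 * Q (Suc k))"
  have h: "0 < h" using Q by (simp add: h_def)
  \<comment> \<open>The last step has length at most \<open>h\<close>; it starts at 0 if \<open>x\<close> is closer to 0 than that.\<close>
  define y where "y = max 0 (x - h)"
  have sum: "(\<Sum>j\<in>{k..<N}. Q j / (exp 1 * Q (Suc j))) = h + (\<Sum>j\<in>{Suc k..<N}. Q j / (exp 1 * Q (Suc j)))"
    using step.hyps by (simp add: h_def sum.atLeast_Suc_lessThan)
  have nonneg: "0 \<le> (\<Sum>j\<in>{Suc k..<N}. Q j / (exp 1 * Q (Suc j)))"
    using Q(1) by (intro sum_nonneg) (auto simp: less_imp_le)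
  have "norm (g n (y + (x - y))) \<le> exp (real n - real k) * Q n"
  proof (rule Bang_step[where g = g and Q = Q and T = T, OF deriv Q bound])
    fix n show "norm (g n y) \<le> exp (real n - real (Suc k)) * Q n"
    proof (rule step.IH)
      show "y \<le> T" using step.prems h by (auto simp: y_def)
      show "y \<le> (\<Sum>j\<in>{Suc k..<N}. Q j / (exp 1 * Q (Suc j)))"
        using step.prems sum nonneg by (auto simp: y_def)
    qed (simp add: y_def)
  qed (use step.prems h in \<open>auto simp: y_def h_def\<close>)
  then show ?case by simp
qed

text \<open>
  Divergence of the series of steps means that every point can be reached from 0 with any
  prescribed flatness \<open>k\<close> left, so the bound at \<open>x\<close> holds for all \<open>k\<close>.
\<close>

theorem Denjoy_Carleman_half_line:
  fixes g :: "nat \<Rightarrow> real \<Rightarrow> complex" and Q :: "nat \<Rightarrow> real"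
  assumes deriv: "\<And>n x. 0 \<le> x \<Longrightarrow> (g n has_vector_derivative g (Suc n) x) (at x within {0..})"
    and Q: "\<And>n. 0 < Q n" "\<And>n. (Q (Suc n))\<^sup>2 \<le> Q n * Q (Suc (Suc n))"
    and div: "\<not> summable (\<lambda>n. Q n / Q (Suc n))"
    and bound: "\<And>n x. 0 \<le> x \<Longrightarrow> x \<le> T \<Longrightarrow> norm (g n x) \<le> Q n"
    and flat: "\<And>n. g n 0 = 0"
    and x: "0 \<le> x" "x \<le> T"
  shows "g n x = 0"
proof -
  define h where "h = (\<lambda>j. Q j / (exp 1 * Q (Suc j)))"
  have hpos: "0 \<le> h j" for j
    using Q(1) by (auto simp: h_def less_imp_le)
  have ndiv: "\<not> summable (\<lambda>j. h (j + k))" for k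
  proof
    assume "summable (\<lambda>j. h (j + k))"
    then have "summable h" by (rule summable_iff_shift[THEN iffD1])
    then have "summable (\<lambda>j. exp 1 * h j)" by (rule summable_mult)
    moreover have "(\<lambda>j. exp 1 * h j) = (\<lambda>j. Q j / Q (Suc j))"
      by (auto simp: h_def)
    ultimately show False using div by simp
  qed
  have le: "norm (g n x) \<le> exp (real n - real k) * Q n" for k
  proof -
    have "\<exists>m. x \<le> (\<Sum>j<m. h (j + k))"
    proof (rule ccontr)
      assume "\<nexists>m. x \<le> (\<Sum>j<m. h (j + k))"
      then have "summable (\<lambda>j. h (j + k))"
        using hpos by (intro summableI_nonneg_bounded[where x = x]) (auto simp: not_le less_imp_le)
      then show False using ndiv[of k] by simp
    qed
    then obtain m where "x \<le> (\<Sum>j<m. h (j + k))" by blast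
    also have "\<dots> = (\<Sum>j\<in>{k..<k + m}. h j)"
      by (rule sum.reindex_bij_witness[of _ "\<lambda>j. j - k" "\<lambda>j. j + k"]) auto
    finally show ?thesis
      unfolding h_def by (intro Bang_steps[where g = g and Q = Q and T = T, OF deriv Q bound flat x]) auto
  qed
  have "(\<lambda>k. exp (real n - real k) * Q n) \<longlonglongrightarrow> 0"
  proof -
    have "(\<lambda>k. exp (real n) * Q n * (exp (-1)) ^ k) \<longlonglongrightarrow> exp (real n) * Q n * 0"
      by (intro tendsto_mult LIMSEQ_realpow_zero tendsto_const) auto
    moreover have "(\<lambda>k. exp (real n) * Q n * (exp (-1)) ^ k) = (\<lambda>k. exp (real n - real k) * Q n)"
      by (auto simp: exp_of_nat_mult [symmetric] exp_diff exp_minus field_simps)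
    ultimately show ?thesis by simp
  qed
  then have "norm (g n x) \<le> 0"
    by (rule LIMSEQ_le_const) (use le in auto)
  then show ?thesis by simp
qed

section \<open>Smooth functions on the half-line\<close>

lemma at_within_half_line_neq_bot:
  assumes "0 \<le> (x::real)"
  shows "at x within {0..} \<noteq> bot"
proof
  assume "at x within {0..} = bot"
  moreover have "at_right x \<le> at x within {0..}"
    using assms by (intro at_le) auto
  ultimately show False
    using trivial_limit_at_right_real[of x] by (metis bot.extremum_unique)
qed

lemma deriv_half_0 [simp]: "deriv_half 0 F = F"
  by (simp add: deriv_half_def)

lemma deriv_half_Suc:
  "deriv_half (Suc n) F x = vector_derivative (deriv_half n F) (at x within {0..})"
  by (simp add: deriv_half_def)

text \<open>
  Iterated one-sided derivatives are awkward to compute with; any sequence of functions in which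
  each is the derivative of the preceding one determines them.
\<close>

lemma deriv_half_eq_chain:
  assumes g0: "\<And>x. 0 \<le> x \<Longrightarrow> F x = g 0 x"
    and deriv: "\<And>n x. 0 \<le> x \<Longrightarrow> (g n has_vector_derivative g (Suc n) x) (at x within {0..})"
    and "0 \<le> x"
  shows "deriv_half n F x = g n x"
    and "(deriv_half n F has_vector_derivative g (Suc n) x) (at x within {0..})"
proof -
  have "(\<forall>x\<ge>0. deriv_half n F x = g n x)
      \<and> (\<forall>x\<ge>0. (deriv_half n F has_vector_derivative g (Suc n) x) (at x within {0..}))" for n
  proof (induction n)
    case 0
    have "(F has_vector_derivative g (Suc 0) x) (at x within {0..})" if "0 \<le> x" for x
      by (rule has_vector_derivative_transform[OF _ _ deriv[OF that]]) (use that g0 in auto)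
    then show ?case by (simp add: g0)
  next
    case (Suc n)
    have eq: "deriv_half (Suc n) F x = g (Suc n) x" if "0 \<le> x" for x
      using vector_derivative_within[OF at_within_half_line_neq_bot[OF that], of "deriv_half n F" "g (Suc n) x"]
        Suc that by (auto simp: deriv_half_Suc)
    have "(deriv_half (Suc n) F has_vector_derivative g (Suc (Suc n)) x) (at x within {0..})" if "0 \<le> x" for x
      by (rule has_vector_derivative_transform[OF _ _ deriv[OF that]]) (use that eq in auto)
    with eq show ?case by simp
  qed
  with \<open>0 \<le> x\<close> show "deriv_half n F x = g n x"
    "(deriv_half n F has_vector_derivative g (Suc n) x) (at x within {0..})"
    by auto
qed

lemma A_classI:
  assumes "\<And>x. x < 0 \<Longrightarrow> F x = 0" "\<And>x. 0 \<le> x \<Longrightarrow> F x = g 0 x"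
    and "\<And>n x. 0 \<le> x \<Longrightarrow> (g n has_vector_derivative g (Suc n) x) (at x within {0..})"
    and "\<And>\<eta>. 1 < \<eta> \<Longrightarrow> \<exists>C>0. \<forall>n. \<forall>x\<ge>0. norm (g n x) \<le> C ^ (n + 1) * M n * exp (\<eta> * x)"
  shows "F \<in> A_class M"
  using assms(1,4) deriv_half_eq_chain[of F g, OF assms(2,3)]
  by (auto simp: A_class_def smooth_half_def intro!: differentiableI_vector)

lemma A_class_neg: "F \<in> A_class M \<Longrightarrow> x < 0 \<Longrightarrow> F x = 0"
  by (simp add: A_class_def)

lemma A_class_bound:
  assumes "F \<in> A_class M" "1 < \<eta>"
  obtains C where "0 < C" "\<And>n x. 0 \<le> x \<Longrightarrow> norm (deriv_half n F x) \<le> C ^ (n + 1) * M n * exp (\<eta> * x)"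
  using assms unfolding A_class_def by blast

lemma A_class_deriv:
  assumes "F \<in> A_class M" "0 \<le> x"
  shows "(deriv_half n F has_vector_derivative deriv_half (Suc n) F x) (at x within {0..})"
  using assms by (auto simp: A_class_def smooth_half_def deriv_half_Suc vector_derivative_works)

lemma power_Suc_superadditive:
  fixes a b :: real
  assumes "0 \<le> a" "0 \<le> b"
  shows "a ^ Suc n + b ^ Suc n \<le> (a + b) ^ Suc n"
proof -
  have "a * a ^ n + b * b ^ n \<le> a * (a + b) ^ n + b * (a + b) ^ n"
    using assms by (intro add_mono mult_left_mono power_mono) auto
  then show ?thesis by (simp add: algebra_simps)
qed

lemma A_class_diff:
  assumes F: "F \<in> A_class M" and G: "G \<in> A_class M" and M: "\<And>n. 0 < M n"
  shows "(\<lambda>x. F x - G x) \<in> A_class M"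
proof (rule A_classI[where g = "\<lambda>n x. deriv_half n F x - deriv_half n G x"])
  fix \<eta> :: real assume \<eta>: "1 < \<eta>"
  obtain C1 where C1: "0 < C1" "\<And>n x. 0 \<le> x \<Longrightarrow> norm (deriv_half n F x) \<le> C1 ^ (n + 1) * M n * exp (\<eta> * x)"
    using A_class_bound[OF F \<eta>] by blast
  obtain C2 where C2: "0 < C2" "\<And>n x. 0 \<le> x \<Longrightarrow> norm (deriv_half n G x) \<le> C2 ^ (n + 1) * M n * exp (\<eta> * x)"
    using A_class_bound[OF G \<eta>] by blast
  have "norm (deriv_half n F x - deriv_half n G x) \<le> (C1 + C2) ^ (n + 1) * M n * exp (\<eta> * x)"
    if "0 \<le> x" for n x
  proof -
    have "norm (deriv_half n F x - deriv_half n G x)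
        \<le> C1 ^ (n + 1) * M n * exp (\<eta> * x) + C2 ^ (n + 1) * M n * exp (\<eta> * x)"
      using C1(2)[OF that, of n] C2(2)[OF that, of n] norm_triangle_ineq4[of "deriv_half n F x" "deriv_half n G x"]
      by linarith
    also have "\<dots> = (C1 ^ (n + 1) + C2 ^ (n + 1)) * M n * exp (\<eta> * x)"
      by (simp add: algebra_simps)
    also have "\<dots> \<le> (C1 + C2) ^ (n + 1) * M n * exp (\<eta> * x)"
      using power_Suc_superadditive[of C1 C2 n] C1(1) C2(1) M[of n] by (intro mult_right_mono) auto
    finally show ?thesis .
  qed
  moreover have "0 < C1 + C2" using C1 C2 by simp
  ultimately show "\<exists>C>0. \<forall>n. \<forall>x\<ge>0. norm (deriv_half n F x - deriv_half n G x) \<le> C ^ (n + 1) * M n * exp (\<eta> * x)"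
    by blast
qed (use A_class_neg[OF F] A_class_neg[OF G] in
      \<open>auto intro!: has_vector_derivative_diff A_class_deriv[OF F] A_class_deriv[OF G]\<close>)

section \<open>Laplace integrals of functions of exponential type\<close>

text \<open>
  The rate \<open>\<eta>\<close> and the constant are both explicit: the rate fixes the half-plane of convergence,
  and the constant carries the dependence on the order of differentiation.
\<close>

definition exp_type :: "real \<Rightarrow> real \<Rightarrow> (real \<Rightarrow> complex) \<Rightarrow> bool" where
  "exp_type K \<eta> F \<longleftrightarrow> continuous_on {0..} F \<and> (\<forall>t\<ge>0. norm (F t) \<le> K * exp (\<eta> * t))"

definition half_laplace :: "(real \<Rightarrow> complex) \<Rightarrow> complex \<Rightarrow> complex" where
  "half_laplace F w = (LINT t:{0..}|lborel. F t * exp (- (of_real t * w)))"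

lemma laplace_eq_half_laplace:
  "z \<in> Omega_all \<Longrightarrow> laplace F z = 1 / z * half_laplace F (1 / z)"
proof -
  have "- of_real t / z = - (of_real t * (1 / z))" for t
    by simp
  moreover assume "z \<in> Omega_all"
  ultimately show ?thesis
    by (simp only: laplace_def half_laplace_def if_True)
qed

lemma A_class_exp_type:
  assumes "F \<in> A_class M" "1 < \<eta>"
  obtains C where "0 < C" "\<And>n. exp_type (C ^ (n + 1) * M n) \<eta> (deriv_half n F)"
proof -
  have "continuous_on {0..} (deriv_half n F)" for n
    by (rule continuous_on_vector_derivative) (use A_class_deriv[OF assms(1)] in auto)
  moreover obtain C where "0 < C"
      "\<And>n x. 0 \<le> x \<Longrightarrow> norm (deriv_half n F x) \<le> C ^ (n + 1) * M n * exp (\<eta> * x)"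
    using A_class_bound[OF assms] by blast
  ultimately show ?thesis
    using that[of C] by (simp add: exp_type_def)
qed

lemma exp_type_K_nonneg: "exp_type K \<eta> F \<Longrightarrow> 0 \<le> K"
  using order_trans[OF norm_ge_zero, of "F 0" K] by (auto simp: exp_type_def dest!: spec[of _ 0])

lemma exp_type_mono:
  assumes "exp_type K \<eta> F" "\<eta> \<le> \<eta>'"
  shows "exp_type K \<eta>' F"
proof -
  have "K * exp (\<eta> * t) \<le> K * exp (\<eta>' * t)" if "0 \<le> t" for t
    using that assms(2) exp_type_K_nonneg[OF assms(1)] by (intro mult_left_mono) (auto intro: mult_right_mono)
  with assms(1) show ?thesis
    by (auto simp: exp_type_def intro: order_trans)
qed

lemma exp_decay_integral:
  assumes "0 < (a::real)"
  shows "set_integrable lborel {c..} (\<lambda>t. exp (- a * t))"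
    and "(LINT t:{c..}|lborel. exp (- a * t)) = exp (- a * c) / a"
proof -
  have "(\<lambda>t. exp (- a * t)) absolutely_integrable_on {c..}"
    by (intro nonnegative_absolutely_integrable_1 integrable_on_exp_minus_to_infinity assms) auto
  then show i: "set_integrable lborel {c..} (\<lambda>t. exp (- a * t))"
    unfolding set_integrable_def by (subst (asm) integrable_completion) auto
  show "(LINT t:{c..}|lborel. exp (- a * t)) = exp (- a * c) / a"
    using set_borel_integral_eq_integral(2)[OF i] has_integral_exp_minus_to_infinity[OF assms]
    by (simp add: integral_unique)
qed

lemma exp_type_kernel_bound:
  assumes "exp_type K \<eta> F" "0 \<le> t"
  shows "norm (F t * exp (- (of_real t * w))) \<le> K * exp (- (Re w - \<eta>) * t)"
proof -
  have "norm (F t * exp (- (of_real t * w))) \<le> K * exp (\<eta> * t) * exp (- (t * Re w))"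
    using assms by (auto simp: norm_mult exp_type_def intro!: mult_right_mono)
  also have "\<dots> = K * exp (- (Re w - \<eta>) * t)"
    by (simp add: algebra_simps flip: exp_add)
  finally show ?thesis .
qed

lemma exp_type_kernel_measurable:
  assumes "exp_type K \<eta> F" "0 \<le> T"
  shows "set_borel_measurable lborel {T..} (\<lambda>t. F t * exp (- (of_real t * w)))"
proof -
  have "(\<lambda>t. indicator {T..} t *\<^sub>R (F t * exp (- (of_real t * w)))) \<in> borel_measurable borel"
    using assms unfolding exp_type_def
    by (intro borel_measurable_continuous_on_indicator continuous_intros) (auto intro: continuous_on_subset)
  then show ?thesis by (simp add: set_borel_measurable_def)
qed

lemma half_laplace_integrable:
  assumes F: "exp_type K \<eta> F" and w: "\<eta> < Re w" and T: "0 \<le> T"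
  shows "set_integrable lborel {T..} (\<lambda>t. F t * exp (- (of_real t * w)))"
proof (rule set_integrable_bound)
  show "set_integrable lborel {T..} (\<lambda>t. K * exp (- (Re w - \<eta>) * t))"
    using exp_decay_integral(1)[of "Re w - \<eta>"] w by (intro set_integrable_mult_right) auto
  show "set_borel_measurable lborel {T..} (\<lambda>t. F t * exp (- (of_real t * w)))"
    by (rule exp_type_kernel_measurable[OF F T])
  have "norm (F t * exp (- (of_real t * w))) \<le> norm (K * exp (- (Re w - \<eta>) * t))" if "T \<le> t" for t
    using exp_type_kernel_bound[OF F, of t w] that T exp_type_K_nonneg[OF F] by simp
  then show "AE t in lborel. t \<in> {T..} \<longrightarrow>
      norm (F t * exp (- (of_real t * w))) \<le> norm (K * exp (- (Re w - \<eta>) * t))"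
    by auto
qed

lemma half_laplace_tail_bound:
  assumes F: "exp_type K \<eta> F" and w: "\<eta> < Re w" and T: "0 \<le> T"
  shows "norm (LINT t:{T..}|lborel. F t * exp (- (of_real t * w)))
    \<le> K * exp (- (Re w - \<eta>) * T) / (Re w - \<eta>)"
proof -
  have "norm (LINT t:{T..}|lborel. F t * exp (- (of_real t * w)))
      \<le> (LINT t:{T..}|lborel. norm (F t * exp (- (of_real t * w))))"
    by (rule set_integral_norm_bound[OF half_laplace_integrable[OF assms]])
  also have "\<dots> \<le> (LINT t:{T..}|lborel. K * exp (- (Re w - \<eta>) * t))"
  proof (rule set_integral_mono)
    show "set_integrable lborel {T..} (\<lambda>t. norm (F t * exp (- (of_real t * w))))"
      by (rule set_integrable_norm[OF half_laplace_integrable[OF assms]])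
    show "set_integrable lborel {T..} (\<lambda>t. K * exp (- (Re w - \<eta>) * t))"
      using exp_decay_integral(1)[of "Re w - \<eta>"] w by (intro set_integrable_mult_right) auto
  qed (use exp_type_kernel_bound[OF F] T in auto)
  also have "\<dots> = K * exp (- (Re w - \<eta>) * T) / (Re w - \<eta>)"
    using exp_decay_integral(2)[of "Re w - \<eta>" T] w by simp
  finally show ?thesis .
qed

lemma half_laplace_bound:
  assumes "exp_type K \<eta> F" "\<eta> < Re w"
  shows "norm (half_laplace F w) \<le> K / (Re w - \<eta>)"
  using half_laplace_tail_bound[OF assms, of 0] by (simp add: half_laplace_def)

lemma half_laplace_cong:
  "(\<And>t. 0 \<le> t \<Longrightarrow> F t = G t) \<Longrightarrow> half_laplace F w = half_laplace G w"
  unfolding half_laplace_def by (intro set_lebesgue_integral_cong) auto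

lemma half_laplace_diff:
  assumes "exp_type K \<eta> F" "exp_type K' \<eta> G" "\<eta> < Re w"
  shows "half_laplace (\<lambda>t. F t - G t) w = half_laplace F w - half_laplace G w"
  using set_integral_diff(2)[OF half_laplace_integrable[OF assms(1,3), of 0] half_laplace_integrable[OF assms(2,3), of 0]]
  by (simp add: half_laplace_def algebra_simps)

lemma half_laplace_add:
  assumes "exp_type K \<eta> F" "exp_type K' \<eta> G" "\<eta> < Re w"
  shows "half_laplace (\<lambda>t. F t + G t) w = half_laplace F w + half_laplace G w"
  using set_integral_add(2)[OF half_laplace_integrable[OF assms(1,3), of 0] half_laplace_integrable[OF assms(2,3), of 0]]
  by (simp add: half_laplace_def algebra_simps)

text \<open>
  As \<open>tau a F\<close> is 0 between 0 and \<open>a\<close>, the substitution \<open>t = a + s\<close> turns the integral over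
  \<open>t \<ge> 0\<close> into the one over \<open>s \<ge> 0\<close>.
\<close>

lemma half_laplace_tau:
  assumes "0 \<le> a"
  shows "half_laplace (tau a F) w = exp (- (of_real a * w)) * half_laplace F w"
proof -
  have "half_laplace (tau a F) w
      = (LINT t|lborel. indicator {0..} (a + 1 * t) *\<^sub>R (tau a F (a + 1 * t) * exp (- (of_real (a + 1 * t) * w))))"
    unfolding half_laplace_def set_lebesgue_integral_def
    by (subst lborel_integral_real_affine[of 1 _ a]) simp_all
  also have "\<dots> = (LINT t|lborel. indicator {0..} t *\<^sub>R (exp (- (of_real a * w)) * (F t * exp (- (of_real t * w)))))"
    using assms by (intro Bochner_Integration.integral_cong)
      (auto simp: indicator_def tau_def algebra_simps exp_diff exp_minus field_simps exp_add)
  also have "\<dots> = exp (- (of_real a * w)) * half_laplace F w"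
    using set_integral_mult_right[of lborel "{0..}" "exp (- (of_real a * w))" "\<lambda>t. F t * exp (- (of_real t * w))"]
    unfolding half_laplace_def set_lebesgue_integral_def by simp
  finally show ?thesis .
qed

lemma tau_kernel_integrable:
  assumes a: "0 \<le> a" and F: "exp_type K \<eta> F" and w: "\<eta> < Re w"
  shows "set_integrable lborel {0..} (\<lambda>t. tau a F t * exp (- (of_real t * w)))"
proof -
  have "integrable lborel (\<lambda>t. exp (- (of_real a * w)) * (indicator {0..} t *\<^sub>R (F t * exp (- (of_real t * w)))))"
    by (rule integrable_mult_right) (use half_laplace_integrable[OF F w, of 0] in \<open>simp add: set_integrable_def\<close>)
  also have "(\<lambda>t. exp (- (of_real a * w)) * (indicator {0..} t *\<^sub>R (F t * exp (- (of_real t * w)))))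
      = (\<lambda>t. indicator {0..} (a + 1 * t) *\<^sub>R (tau a F (a + 1 * t) * exp (- (of_real (a + 1 * t) * w))))"
    using a by (auto simp: fun_eq_iff indicator_def tau_def algebra_simps exp_diff exp_minus field_simps exp_add)
  finally show ?thesis
    unfolding set_integrable_def by (subst (asm) lborel_integrable_real_affine_iff) simp_all
qed

text \<open>
  The derivative of \<open>F t * exp (- t w)\<close> integrates to the boundary value \<open>- F 0\<close>, since this
  product tends to 0 at infinity.
\<close>

lemma half_laplace_by_parts:
  assumes F: "exp_type K \<eta> F" and F': "exp_type K' \<eta> F'" and w: "\<eta> < Re w"
    and deriv: "\<And>t. 0 \<le> t \<Longrightarrow> (F has_vector_derivative F' t) (at t within {0..})"
  shows "w * half_laplace F w = F 0 + half_laplace F' w"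
proof -
  define h where "h = (\<lambda>t. (F' t - w * F t) * exp (- (of_real t * w)))"
  have h: "h = (\<lambda>t. F' t * exp (- (of_real t * w)) - w * (F t * exp (- (of_real t * w))))"
    by (auto simp: h_def algebra_simps)
  note i = half_laplace_integrable[OF F w, of 0] half_laplace_integrable[OF F' w, of 0]
  have hi: "set_integrable lborel {0..} h"
    unfolding h using i by (intro set_integral_diff(1) set_integrable_mult_right) auto
  have int_h: "(LINT t:{0..}|lborel. h t) = half_laplace F' w - w * half_laplace F w"
    unfolding h half_laplace_def using i by (subst set_integral_diff(2)) auto
  have FTC: "(LINT t:{0..b}|lborel. h t) = F b * exp (- (of_real b * w)) - F 0" if "0 \<le> b" for b
  proof -
    have "(LINT t|lborel. indicator {0..b} t *\<^sub>R h t)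
        = F b * exp (- (of_real b * w)) - F 0 * exp (- (of_real 0 * w))"
    proof (rule integral_FTC_Icc[OF that])
      fix t assume t: "0 \<le> t" "t \<le> b"
      have "((\<lambda>t. F t * exp (- (of_real t * w))) has_vector_derivative
          F t * (exp (- (of_real t * w)) * (- w)) + F' t * exp (- (of_real t * w))) (at t within {0..b})"
      proof (rule has_vector_derivative_mult)
        show "(F has_vector_derivative F' t) (at t within {0..b})"
          by (rule has_vector_derivative_within_subset[OF deriv[OF t(1)]]) auto
        have "((\<lambda>t. exp (- (of_real t * w))) has_vector_derivative
            1 * exp (- (of_real t * w)) * (- w)) (at t within {0..b})"
          by (rule has_vector_derivative_real_field[where f = "\<lambda>z. exp (- (z * w))"])
             (auto intro!: derivative_eq_intros)
        then show "((\<lambda>t. exp (- (of_real t * w))) has_vector_derivative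
            exp (- (of_real t * w)) * (- w)) (at t within {0..b})" by simp
      qed
      then show "((\<lambda>t. F t * exp (- (of_real t * w))) has_vector_derivative h t) (at t within {0..b})"
        by (simp add: h_def algebra_simps)
    next
      show "continuous_on {0..b} h"
        unfolding h_def using F F' by (intro continuous_intros) (auto simp: exp_type_def intro: continuous_on_subset)
    qed
    then show ?thesis by (simp add: set_lebesgue_integral_def)
  qed
  have "((\<lambda>b. LINT t:{0..b}|lborel. h t) \<longlongrightarrow> (LINT t:{0..}|lborel. h t)) at_top"
    by (intro tendsto_set_lebesgue_integral_at_top hi) auto
  moreover have "((\<lambda>b. LINT t:{0..b}|lborel. h t) \<longlongrightarrow> 0 - F 0) at_top"
  proof (rule Lim_transform_eventually)
    have "((\<lambda>b. K * exp (- (Re w - \<eta>) * b)) \<longlongrightarrow> K * 0) at_top"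
    proof (intro tendsto_mult tendsto_const filterlim_compose[OF exp_at_bot])
      show "filterlim (\<lambda>b. - (Re w - \<eta>) * b) at_bot at_top"
        by (rule filterlim_tendsto_neg_mult_at_bot[OF tendsto_const]) (use w in \<open>auto simp: filterlim_ident\<close>)
    qed
    moreover have "\<forall>\<^sub>F b in at_top. norm (F b * exp (- (of_real b * w))) \<le> K * exp (- (Re w - \<eta>) * b)"
      using eventually_ge_at_top[of 0] by eventually_elim (rule exp_type_kernel_bound[OF F])
    ultimately have "((\<lambda>b. F b * exp (- (of_real b * w))) \<longlongrightarrow> 0) at_top"
      by (simp add: Lim_null_comparison)
    then show "((\<lambda>b. F b * exp (- (of_real b * w)) - F 0) \<longlongrightarrow> 0 - F 0) at_top"
      by (intro tendsto_intros)
    show "\<forall>\<^sub>F b in at_top. F b * exp (- (of_real b * w)) - F 0 = (LINT t:{0..b}|lborel. h t)"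
      using eventually_ge_at_top[of 0] by eventually_elim (simp add: FTC)
  qed
  ultimately have "(LINT t:{0..}|lborel. h t) = - F 0"
    using tendsto_unique[OF trivial_limit_at_top_linorder] by fastforce
  with int_h show ?thesis by (simp add: algebra_simps)
qed

lemma finite_laplace_holomorphic:
  assumes "continuous_on {a..b} F"
  shows "(\<lambda>w. integral {a..b} (\<lambda>t. F t * exp (- (of_real t * w)))) holomorphic_on S"
proof (rule holomorphic_on_subset)
  have "(\<lambda>w. integral (cbox a b) (\<lambda>t. F t * exp (- (of_real t * w)))) holomorphic_on UNIV"
  proof (rule leibniz_rule_holomorphic[where fx = "\<lambda>w t. F t * (exp (- (of_real t * w)) * (- of_real t))"])
    show "(\<lambda>t. F t * exp (- (of_real t * w))) integrable_on cbox a b" for w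
      using assms by (intro integrable_continuous continuous_intros) auto
    have "continuous_on (UNIV \<times> cbox a b) (F \<circ> snd)"
      by (rule continuous_on_compose) (auto intro!: continuous_intros continuous_on_subset[OF assms])
    then show "continuous_on (UNIV \<times> cbox a b) (\<lambda>(w, t). F t * (exp (- (of_real t * w)) * (- of_real t)))"
      unfolding case_prod_unfold by (intro continuous_intros) (auto simp: o_def)
  qed (auto intro!: derivative_eq_intros)
  then show "(\<lambda>w. integral {a..b} (\<lambda>t. F t * exp (- (of_real t * w)))) holomorphic_on UNIV"
    by simp
qed simp

lemma finite_laplace_eq:
  fixes F :: "real \<Rightarrow> complex"
  assumes "continuous_on {0..b} F"
  shows "(LINT t:{0..b}|lborel. F t * exp (- (of_real t * w))) = integral {0..b} (\<lambda>t. F t * exp (- (of_real t * w)))"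
  by (rule set_borel_integral_eq_integral(2), rule borel_integrable_atLeastAtMost')
     (intro continuous_intros assms)

text \<open>
  Integrals over \<open>[0, n]\<close> are entire in \<open>w\<close> and converge locally uniformly.
\<close>

lemma half_laplace_holomorphic:
  assumes F: "exp_type K \<eta> F"
  shows "half_laplace F holomorphic_on {w. \<eta> < Re w}"
proof (rule holomorphic_uniform_sequence)
  show "open {w. \<eta> < Re w}"
    by (rule open_halfspace_Re_gt)
  have cont: "continuous_on {0..b} F" for b
    using F by (auto simp: exp_type_def intro: continuous_on_subset)
  define f where "f = (\<lambda>(b::real) w. LINT t:{0..b}|lborel. F t * exp (- (of_real t * w)))"
  have f: "f b = (\<lambda>w. integral {0..b} (\<lambda>t. F t * exp (- (of_real t * w))))" for b
    by (simp add: f_def finite_laplace_eq[OF cont])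
  show "f (real n) holomorphic_on {w. \<eta> < Re w}" for n
    unfolding f by (rule finite_laplace_holomorphic[OF cont])
  fix w assume w: "w \<in> {w. \<eta> < Re w}"
  define d where "d = (Re w - \<eta>) / 2"
  have d: "0 < d" using w by (simp add: d_def)
  have Re: "\<eta> + d \<le> Re u" if "u \<in> cball w d" for u
  proof -
    have "\<bar>Re w - Re u\<bar> \<le> d"
      using that abs_Re_le_cmod[of "w - u"] by (simp add: dist_norm)
    moreover have "2 * d = Re w - \<eta>" by (simp add: d_def)
    ultimately show ?thesis by linarith
  qed
  have "uniform_limit (cball w d) f (half_laplace F) at_top"
    unfolding f_def half_laplace_def
  proof (rule uniform_limit_set_lebesgue_integral_at_top)
    show "set_integrable lborel {0..} (\<lambda>t. K * exp (- d * t))"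
      using exp_decay_integral(1)[OF d] by (intro set_integrable_mult_right) auto
    fix u t assume u: "u \<in> cball w d" and t: "(t::real) \<ge> 0"
    have "norm (F t * exp (- (of_real t * u))) \<le> K * exp (- (Re u - \<eta>) * t)"
      by (rule exp_type_kernel_bound[OF F t])
    also have "\<dots> \<le> K * exp (- d * t)"
    proof -
      have "d * t \<le> (Re u - \<eta>) * t"
        using Re[OF u] t by (intro mult_right_mono) auto
      then show ?thesis
        using exp_type_K_nonneg[OF F] by (intro mult_left_mono) (auto simp: algebra_simps)
    qed
    finally show "norm (F t * exp (- (of_real t * u))) \<le> K * exp (- d * t)" .
  qed (auto intro: exp_type_kernel_measurable[OF F])
  then have "uniform_limit (cball w d) (\<lambda>n. f (real n)) (half_laplace F) sequentially"
    by (rule filterlim_compose[OF _ filterlim_real_sequentially])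
  moreover have "cball w d \<subseteq> {w. \<eta> < Re w}"
    using Re d by force
  ultimately show "\<exists>d. 0 < d \<and> cball w d \<subseteq> {w. \<eta> < Re w} \<and>
      uniform_limit (cball w d) (\<lambda>n. f (real n)) (half_laplace F) sequentially"
    using d by blast
qed

section \<open>Uniqueness for Laplace integrals\<close>

text \<open>
  For \<open>T < d\<close>, the entire function \<open>E w = \<integral>\<close> of \<open>F t * exp ((T - t) w)\<close> over \<open>[0, T]\<close> is
  trivially bounded on a left half-plane. On a right half-plane \<open>E w\<close> is \<open>exp (T w)\<close> times the
  difference between the full integral, where the assumed decay compensates the factor, and the
  tail from \<open>T\<close> on, which is itself of size \<open>exp (- T * Re w)\<close>. So \<open>E\<close> is constant by
  Liouville's theorem, and as it tends to 0 along the negative axis it is 0. The value \<open>E 0\<close> is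
  the integral of \<open>F\<close> over \<open>[0, T]\<close>, and \<open>T\<close> is arbitrary.
\<close>

lemma half_laplace_decay_imp_zero:
  assumes F: "exp_type K \<eta> F" and \<sigma>: "\<eta> < \<sigma>"
    and decay: "\<And>w. \<sigma> \<le> Re w \<Longrightarrow> norm (half_laplace F w) \<le> K' * exp (- (d * Re w))"
    and t: "0 \<le> t" "t < d"
  shows "F t = 0"
proof -
  have K0: "0 \<le> K" by (rule exp_type_K_nonneg[OF F])
  have cont: "continuous_on S F" if "S \<subseteq> {0..}" for S
    using F that by (auto simp: exp_type_def intro: continuous_on_subset)
  have primitive: "integral {0..T} F = 0" if T: "0 \<le> T" "T < d" for T
  proof -
    define E where "E = (\<lambda>w. exp (of_real T * w) * integral {0..T} (\<lambda>t. F t * exp (- (of_real t * w))))"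
    define B where "B = K * exp (\<bar>\<eta>\<bar> * T)"
    have FB: "norm (F t) \<le> B" if "0 \<le> t" "t \<le> T" for t
    proof -
      have "\<eta> * t \<le> \<bar>\<eta>\<bar> * T" using that by (intro mult_mono) auto
      then have "K * exp (\<eta> * t) \<le> B" unfolding B_def using K0 by (intro mult_left_mono) auto
      moreover have "norm (F t) \<le> K * exp (\<eta> * t)" using F that by (auto simp: exp_type_def)
      ultimately show ?thesis by simp
    qed
    have B0: "0 \<le> B" using K0 by (simp add: B_def)
    have hol: "E holomorphic_on UNIV"
      unfolding E_def by (intro holomorphic_intros finite_laplace_holomorphic cont) auto
    have E_eq: "E w = integral {0..T} (\<lambda>t. F t * exp (of_real (T - t) * w))" for w
      unfolding E_def integral_mult_right[symmetric]
      by (intro integral_cong) (simp add: algebra_simps exp_diff exp_minus field_simps)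
    have E_bound: "norm (E w) \<le> integral {0..T} (\<lambda>t. B * exp ((T - t) * Re w))" for w
      unfolding E_eq
    proof (rule integral_norm_bound_integral)
      show "(\<lambda>t. F t * exp (of_real (T - t) * w)) integrable_on {0..T}"
        by (intro integrable_continuous_real continuous_intros cont) auto
      show "(\<lambda>t. B * exp ((T - t) * Re w)) integrable_on {0..T}"
        by (intro integrable_continuous_real continuous_intros)
      show "norm (F t * exp (of_real (T - t) * w)) \<le> B * exp ((T - t) * Re w)" if "t \<in> {0..T}" for t
        using FB[of t] that by (auto simp: norm_mult intro!: mult_right_mono)
    qed
    have left: "norm (E w) \<le> B * exp (T * \<bar>\<sigma>\<bar>) * T" if w: "Re w \<le> \<sigma>" for w
    proof -
      have "integral {0..T} (\<lambda>t. B * exp ((T - t) * Re w)) \<le> integral {0..T} (\<lambda>t. B * exp (T * \<bar>\<sigma>\<bar>))"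
      proof (rule integral_le)
        show "(\<lambda>t. B * exp ((T - t) * Re w)) integrable_on {0..T}"
          by (intro integrable_continuous_real continuous_intros)
        fix t assume t: "t \<in> {0..T}"
        have "(T - t) * Re w \<le> (T - t) * \<bar>\<sigma>\<bar>" using t w by (intro mult_left_mono) auto
        also have "\<dots> \<le> T * \<bar>\<sigma>\<bar>" using t by (intro mult_right_mono) auto
        finally show "B * exp ((T - t) * Re w) \<le> B * exp (T * \<bar>\<sigma>\<bar>)"
          using B0 by (intro mult_left_mono) auto
      qed auto
      with E_bound[of w] T show ?thesis by (simp add: mult_ac)
    qed
    have right: "norm (E w) \<le> \<bar>K'\<bar> * exp ((T - d) * \<sigma>) + K * exp (\<eta> * T) / (\<sigma> - \<eta>)" if w: "\<sigma> \<le> Re w" for w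
    proof -
      define tl where "tl = (LINT t:{T..}|lborel. F t * exp (- (of_real t * w)))"
      have w': "\<eta> < Re w" using w \<sigma> by simp
      have "half_laplace F w = (LINT t:{0..T} \<union> {T..}|lborel. F t * exp (- (of_real t * w)))"
      proof -
        have "{0..} = {0..T} \<union> {T..}" using T by auto
        then show ?thesis by (simp only: half_laplace_def)
      qed
      also have "\<dots> = (LINT t:{0..T}|lborel. F t * exp (- (of_real t * w))) + tl"
        unfolding tl_def
      proof (rule set_integral_Un_AE)
        show "AE t in lborel. \<not> (t \<in> {0..T} \<and> t \<in> {T..})"
          using AE_lborel_singleton[of T] by eventually_elim auto
        show "set_integrable lborel {0..T} (\<lambda>t. F t * exp (- (of_real t * w)))"
          by (rule set_integrable_subset[OF half_laplace_integrable[OF F w', of 0]]) auto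
        show "set_integrable lborel {T..} (\<lambda>t. F t * exp (- (of_real t * w)))"
          by (rule half_laplace_integrable[OF F w' T(1)])
      qed auto
      finally have "E w = exp (of_real T * w) * (half_laplace F w - tl)"
        using finite_laplace_eq[OF cont, of T w] by (simp add: E_def)
      then have "norm (E w) = exp (T * Re w) * norm (half_laplace F w - tl)"
        by (simp add: norm_mult)
      also have "\<dots> \<le> exp (T * Re w) * (norm (half_laplace F w) + norm tl)"
        by (intro mult_left_mono norm_triangle_ineq4) auto
      also have "\<dots> \<le> exp (T * Re w) * (\<bar>K'\<bar> * exp (- (d * Re w)) + K * exp (- (Re w - \<eta>) * T) / (Re w - \<eta>))"
      proof (intro mult_left_mono add_mono)
        have "K' * exp (- (d * Re w)) \<le> \<bar>K'\<bar> * exp (- (d * Re w))"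
          by (intro mult_right_mono) auto
        with decay[OF w] show "norm (half_laplace F w) \<le> \<bar>K'\<bar> * exp (- (d * Re w))" by linarith
        show "norm tl \<le> K * exp (- (Re w - \<eta>) * T) / (Re w - \<eta>)"
          unfolding tl_def by (rule half_laplace_tail_bound[OF F w' T(1)])
      qed auto
      also have "\<dots> = \<bar>K'\<bar> * exp ((T - d) * Re w) + K * exp (\<eta> * T) / (Re w - \<eta>)"
      proof -
        have "exp (T * Re w) * exp (- (d * Re w)) = exp ((T - d) * Re w)"
          by (simp add: algebra_simps flip: exp_add)
        moreover have "exp (T * Re w) * exp (- (Re w - \<eta>) * T) = exp (\<eta> * T)"
          by (simp add: algebra_simps flip: exp_add)
        ultimately show ?thesis
          unfolding distrib_left by (metis mult.left_commute times_divide_eq_right)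
      qed
      also have "\<dots> \<le> \<bar>K'\<bar> * exp ((T - d) * \<sigma>) + K * exp (\<eta> * T) / (\<sigma> - \<eta>)"
      proof (intro add_mono mult_left_mono divide_left_mono)
        show "exp ((T - d) * Re w) \<le> exp ((T - d) * \<sigma>)"
          using w T by (simp add: mult_left_mono_neg)
      qed (use w \<sigma> K0 in auto)
      finally show ?thesis .
    qed
    have "bounded (range E)"
      unfolding bounded_iff
    proof (intro exI ballI)
      fix y assume "y \<in> range E"
      then obtain w where y: "y = E w" by blast
      show "norm y \<le> max (B * exp (T * \<bar>\<sigma>\<bar>) * T) (\<bar>K'\<bar> * exp ((T - d) * \<sigma>) + K * exp (\<eta> * T) / (\<sigma> - \<eta>))"
        using left[of w] right[of w] y by (cases "Re w \<le> \<sigma>") (auto simp: le_max_iff_disj)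
    qed
    then have "E constant_on UNIV"
      by (rule Liouville_theorem[OF hol])
    then obtain c where c: "\<And>w. E w = c"
      by (auto simp: constant_on_def)
    \<comment> \<open>The constant is \<open>E 0\<close>, and it vanishes since \<open>E\<close> decays along the negative axis.\<close>
    have "norm c \<le> B / s" if s: "0 < s" for s
    proof -
      have "((\<lambda>t. B * exp ((T - t) * - s)) has_integral
          (B * exp ((T - T) * - s) / s - B * exp ((T - 0) * - s) / s)) {0..T}"
        by (rule fundamental_theorem_of_calculus)
           (use T s in \<open>auto simp: simp flip: has_real_derivative_iff_has_vector_derivative intro!: derivative_eq_intros\<close>)
      then have "integral {0..T} (\<lambda>t. B * exp ((T - t) * - s))
          = B * exp ((T - T) * - s) / s - B * exp ((T - 0) * - s) / s"
        by (rule integral_unique)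
      also have "\<dots> \<le> B / s"
        using B0 s by simp
      finally show ?thesis
        using E_bound[of "of_real (- s)"] c by simp
    qed
    moreover have "((\<lambda>s. B / s) \<longlongrightarrow> 0) at_top"
      by (intro tendsto_divide_0[OF tendsto_const] filterlim_at_top_imp_at_infinity filterlim_ident)
    ultimately have "norm c \<le> 0"
      by (intro tendsto_lowerbound[where F = at_top and f = "\<lambda>s. B / s"])
         (auto intro: eventually_mono[OF eventually_gt_at_top[of 0]])
    with c[of 0] show ?thesis
      by (simp add: E_def)
  qed
  obtain u where u: "t < u" "u < d" using dense[OF t(2)] by blast
  have "((\<lambda>x. integral {0..x} F) has_vector_derivative F t) (at t within {0..u})"
    by (rule integral_has_vector_derivative) (use t u cont in auto)
  then have "((\<lambda>x. 0) has_vector_derivative F t) (at t within {0..u})"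
    by (rule has_vector_derivative_transform[rotated 2]) (use t u primitive in auto)
  moreover have "((\<lambda>x. 0) has_vector_derivative 0) (at t within {0..u})"
    by (rule has_vector_derivative_const)
  ultimately show ?thesis
    using vector_derivative_unique_within_closed_interval[of 0 u t "\<lambda>x. 0" "F t" 0] t u
    by simp
qed

text \<open>
  The integral of \<open>F - G\<close> is 0, so it decays at every exponential rate.
\<close>

lemma half_laplace_inject:
  assumes F: "exp_type K \<eta> F" and G: "exp_type K' \<eta> G"
    and eq: "\<And>w. \<eta> < Re w \<Longrightarrow> half_laplace F w = half_laplace G w"
    and t: "0 \<le> t"
  shows "F t = G t"
proof -
  have FG: "exp_type (K + K') \<eta> (\<lambda>t. F t - G t)"
    unfolding exp_type_def
  proof (intro conjI allI impI)
    show "continuous_on {0..} (\<lambda>t. F t - G t)"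
      using F G by (intro continuous_intros) (auto simp: exp_type_def)
    fix t :: real assume "0 \<le> t"
    then have "norm (F t) \<le> K * exp (\<eta> * t)" "norm (G t) \<le> K' * exp (\<eta> * t)"
      using F G by (auto simp: exp_type_def)
    then show "norm (F t - G t) \<le> (K + K') * exp (\<eta> * t)"
      using norm_triangle_ineq4[of "F t" "G t"] by (simp add: algebra_simps)
  qed
  have "F t - G t = 0"
    by (rule half_laplace_decay_imp_zero[OF FG, of "\<eta> + 1" 0 "t + 1"])
       (use eq t half_laplace_diff[OF F G] in auto)
  then show ?thesis by simp
qed

section \<open>Vanishing exponential sums of Laplace integrals\<close>

lemma vanishing_imp_derivative_zero:
  assumes "(F has_vector_derivative D) (at t within {0..})" "0 \<le> t" "t < d"
    and "\<And>x. 0 \<le> x \<Longrightarrow> x < d \<Longrightarrow> F x = 0"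
  shows "D = (0 :: complex)"
proof -
  obtain u where u: "t < u" "u < d" using dense[OF assms(3)] by blast
  have "(F has_vector_derivative D) (at t within {0..u})"
    by (rule has_vector_derivative_within_subset[OF assms(1)]) auto
  then have "((\<lambda>x. 0) has_vector_derivative D) (at t within {0..u})"
    by (rule has_vector_derivative_transform[rotated 2]) (use u assms in auto)
  moreover have "((\<lambda>x. 0) has_vector_derivative 0) (at t within {0..u})"
    by (rule has_vector_derivative_const)
  ultimately show ?thesis
    using vector_derivative_unique_within_closed_interval[of 0 u t "\<lambda>x. 0" D 0] assms(2) u
    by simp
qed

text \<open>
  Log-convexity of \<open>M\<close> is available only from some index \<open>n0\<close> on, so quasianalyticity is applied to the
  derivative of order \<open>n0\<close>. Lower derivatives vanish at 0, hence vanish by integration.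
\<close>

lemma A_class_vanishing_germ_imp_zero:
  assumes reg: "regular_seq M" and div: "\<not> summable (\<lambda>n. M n / M (n + 1))"
    and F: "F \<in> A_class M" and "0 < d" and van: "\<And>t. 0 \<le> t \<Longrightarrow> t < d \<Longrightarrow> F t = 0"
  shows "F = (\<lambda>_. 0)"
proof -
  have pos: "0 < M n" for n using regular_seq_pos[OF reg] .
  have "\<forall>t. 0 \<le> t \<longrightarrow> t < d \<longrightarrow> deriv_half n F t = 0" for n
  proof (induction n)
    case (Suc n)
    then show ?case
      using vanishing_imp_derivative_zero[OF A_class_deriv[OF F, of _ n]] by blast
  qed (use van in simp)
  then have flat: "deriv_half n F 0 = 0" for n
    using \<open>0 < d\<close> by simp
  obtain n0 where n0: "\<And>n. n0 \<le> n \<Longrightarrow> (M (Suc n))\<^sup>2 \<le> M n * M (Suc (Suc n))"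
    using regular_seq_eventually_log_convex[OF reg] by (auto simp: eventually_sequentially)
  obtain C where C: "0 < C" "\<And>n x. 0 \<le> x \<Longrightarrow> norm (deriv_half n F x) \<le> C ^ (n + 1) * M n * exp (2 * x)"
    using A_class_bound[OF F, of 2] by auto
  have high: "deriv_half n0 F x = 0" if x: "0 \<le> x" for x
  proof -
    define Q where "Q = (\<lambda>n. C ^ (n + n0 + 1) * M (n + n0) * exp (2 * x))"
    have "deriv_half (0 + n0) F x = 0"
    proof (rule Denjoy_Carleman_half_line[where g = "\<lambda>n. deriv_half (n + n0) F" and Q = Q and T = x and n = 0])
      show "(deriv_half (n + n0) F has_vector_derivative deriv_half (Suc n + n0) F t) (at t within {0..})"
        if "0 \<le> t" for n t
        using A_class_deriv[OF F that, of "n + n0"] by simp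
      show "0 < Q n" for n using C pos by (simp add: Q_def)
      show "(Q (Suc n))\<^sup>2 \<le> Q n * Q (Suc (Suc n))" for n
      proof -
        have "(Q (Suc n))\<^sup>2 = (C ^ (n + n0 + 2) * exp (2 * x))\<^sup>2 * (M (Suc (n + n0)))\<^sup>2"
          by (simp add: Q_def power_mult_distrib)
        also have "\<dots> \<le> (C ^ (n + n0 + 2) * exp (2 * x))\<^sup>2 * (M (n + n0) * M (Suc (Suc (n + n0))))"
          using n0[of "n + n0"] by (intro mult_left_mono) auto
        also have "\<dots> = Q n * Q (Suc (Suc n))"
          by (simp add: Q_def power2_eq_square algebra_simps)
        finally show ?thesis .
      qed
      show "\<not> summable (\<lambda>n. Q n / Q (Suc n))"
      proof
        assume "summable (\<lambda>n. Q n / Q (Suc n))"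
        then have "summable (\<lambda>n. C * (Q n / Q (Suc n)))" by (rule summable_mult)
        moreover have "(\<lambda>n. C * (Q n / Q (Suc n))) = (\<lambda>n. M (n + n0) / M (n + n0 + 1))"
          using C(1) by (auto simp: Q_def fun_eq_iff)
        ultimately have "summable (\<lambda>n. M (n + n0) / M (n + n0 + 1))" by simp
        then show False
          using div summable_iff_shift[of "\<lambda>n. M n / M (n + 1)" n0] by simp
      qed
      show "norm (deriv_half (n + n0) F t) \<le> Q n" if "0 \<le> t" "t \<le> x" for n t
      proof -
        have "norm (deriv_half (n + n0) F t) \<le> C ^ (n + n0 + 1) * M (n + n0) * exp (2 * t)"
          by (rule C(2)[OF that(1)])
        also have "\<dots> \<le> Q n"
          unfolding Q_def using that C(1) pos[of "n + n0"] by (intro mult_left_mono) auto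
        finally show ?thesis .
      qed
    qed (use flat x in auto)
    then show ?thesis by simp
  qed
  have "\<forall>x\<ge>0. deriv_half n F x = 0" if "n \<le> n0" for n
    using that
  proof (induction n rule: inc_induct)
    case base
    then show ?case using high by blast
  next
    case (step n)
    have "(deriv_half n F has_vector_derivative 0) (at x within {0..})" if "x \<in> {0..}" for x
      using A_class_deriv[OF F, of x n] step.IH that by simp
    then obtain c where "\<And>x. x \<in> {0..} \<Longrightarrow> deriv_half n F x = c"
      using has_vector_derivative_zero_constant[of "{0..}" "deriv_half n F"] by (auto simp: convex_real_interval)
    then show ?case using flat[of n] by (metis atLeast_iff order_refl)
  qed
  from this[of 0] A_class_neg[OF F] show ?thesis
    by (auto simp: fun_eq_iff) (metis linorder_not_le)
qed

text \<open>
  The transform of the first remaining term equals a sum of later ones, which are smaller by the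
  factor \<open>exp (- (a (j + 1) - a j) * Re w)\<close>; this makes \<open>F j\<close> vanish on an initial interval.
  For the last term the sum is empty and any length of interval will do.
\<close>

lemma A_class_laplace_sum_zero:
  fixes a :: "nat \<Rightarrow> real" and F :: "nat \<Rightarrow> real \<Rightarrow> complex"
  assumes reg: "regular_seq M" and div: "\<not> summable (\<lambda>n. M n / M (n + 1))"
    and a: "\<And>i j. i < j \<Longrightarrow> j \<le> N \<Longrightarrow> a i < a j"
    and F: "\<And>j. j \<le> N \<Longrightarrow> F j \<in> A_class M"
    and zero: "\<And>w. 1 < Re w \<Longrightarrow> (\<Sum>j\<le>N. exp (- (of_real (a j) * w)) * half_laplace (F j) w) = 0"
    and "j \<le> N"
  shows "F j = (\<lambda>_. 0)"
  using \<open>j \<le> N\<close>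
proof (induction j rule: less_induct)
  case (less j)
  have "\<exists>K. exp_type K 2 (F i)" if i: "i \<le> N" for i
  proof -
    obtain C where "\<And>n. exp_type (C ^ (n + 1) * M n) 2 (deriv_half n (F i))"
      using A_class_exp_type[OF F[OF i], of 2] by auto
    from this[of 0] show ?thesis by auto
  qed
  then obtain K where K: "\<And>i. i \<le> N \<Longrightarrow> exp_type (K i) 2 (F i)"
    by metis
  define d where "d = (if j = N then 1 else a (Suc j) - a j)"
  have d: "0 < d" using a[of j "Suc j"] less.prems by (auto simp: d_def)
  have gap: "d \<le> a i - a j" if "j < i" "i \<le> N" for i
    using that a[of "Suc j" i] by (cases "i = Suc j") (auto simp: d_def)
  show ?case
  proof (rule A_class_vanishing_germ_imp_zero[OF reg div F[OF less.prems] d])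
    fix t :: real assume t: "0 \<le> t" "t < d"
    show "F j t = 0"
    proof (rule half_laplace_decay_imp_zero[OF K[OF less.prems], of 3 "\<Sum>i\<in>{j<..N}. K i" d t])
      fix w assume w: "3 \<le> Re w"
      define S where "S = (\<Sum>i\<in>{j<..N}. exp (- (of_real (a i) * w)) * half_laplace (F i) w)"
      have split: "{..N} = {..<j} \<union> insert j {j<..N}" using less.prems by auto
      have low: "(\<Sum>i<j. exp (- (of_real (a i) * w)) * half_laplace (F i) w) = 0"
        using less.IH less.prems by (intro sum.neutral) (auto simp: half_laplace_def)
      have "0 = (\<Sum>i\<le>N. exp (- (of_real (a i) * w)) * half_laplace (F i) w)"
        using zero[of w] w by simp
      also have "\<dots> = exp (- (of_real (a j) * w)) * half_laplace (F j) w + S"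
        unfolding split by (subst sum.union_disjoint) (auto simp: low S_def)
      finally have "exp (- (of_real (a j) * w)) * half_laplace (F j) w = - S"
        unfolding eq_neg_iff_add_eq_0 by (rule sym)
      then have "exp (of_real (a j) * w) * (exp (- (of_real (a j) * w)) * half_laplace (F j) w)
          = exp (of_real (a j) * w) * (- S)"
        by simp
      then have "half_laplace (F j) w = - (exp (of_real (a j) * w) * S)"
        by (simp add: mult.assoc[symmetric] flip: exp_add)
      also have "norm \<dots> = norm (\<Sum>i\<in>{j<..N}. exp (- (of_real (a i - a j) * w)) * half_laplace (F i) w)"
      proof -
        have "exp (of_real (a j) * w) * exp (- (of_real (a i) * w)) = exp (- (of_real (a i - a j) * w))" for i
          by (simp add: algebra_simps flip: exp_add)
        then show ?thesis
          unfolding S_def sum_distrib_left norm_minus_cancel mult.assoc[symmetric] by simp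
      qed
      also have "\<dots> \<le> (\<Sum>i\<in>{j<..N}. exp (- (d * Re w)) * K i)"
      proof (rule sum_norm_le)
        fix i assume i: "i \<in> {j<..N}"
        have "norm (half_laplace (F i) w) \<le> K i / (Re w - 2)"
          by (rule half_laplace_bound[OF K]) (use i w in auto)
        also have "\<dots> \<le> K i / 1"
          using w exp_type_K_nonneg[OF K[of i]] i by (intro divide_left_mono) auto
        finally have "norm (half_laplace (F i) w) \<le> K i" by simp
        moreover have "d * Re w \<le> (a i - a j) * Re w"
          using gap[of i] i w by (intro mult_right_mono) auto
        ultimately show "norm (exp (- (of_real (a i - a j) * w)) * half_laplace (F i) w) \<le> exp (- (d * Re w)) * K i"
          by (auto simp: norm_mult intro!: mult_mono)
      qed
      finally show "norm (half_laplace (F j) w) \<le> (\<Sum>i\<in>{j<..N}. K i) * exp (- (d * Re w))"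
        by (simp add: sum_distrib_right mult.commute)
    qed (use t in auto)
  qed
qed

section \<open>The discs Omega and asymptotic expansions at the origin\<close>

text \<open>
  Inversion maps the half-plane \<open>\<eta> \<le> Re w\<close> to the disc of radius \<open>1 / (2 * \<eta>)\<close> that touches
  the imaginary axis at the origin.
\<close>

lemma Re_inverse_ge_iff:
  assumes "0 < \<eta>" "z \<noteq> 0"
  shows "\<eta> \<le> Re (1 / z) \<longleftrightarrow> norm (of_real (1 / (2 * \<eta>)) - z) \<le> 1 / (2 * \<eta>)"
    and "\<eta> < Re (1 / z) \<longleftrightarrow> norm (of_real (1 / (2 * \<eta>)) - z) < 1 / (2 * \<eta>)"
proof -
  define r where "r = 1 / (2 * \<eta>)"
  have r: "0 < r" "2 * r * \<eta> = 1" using assms by (simp_all add: r_def)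
  have z: "0 < (norm z)\<^sup>2" using assms by simp
  have Re: "Re (1 / z) = Re z / (norm z)\<^sup>2"
    by (simp add: Re_divide cmod_power2)
  have expand: "(norm (of_real r - z))\<^sup>2 = (norm z)\<^sup>2 - 2 * r * Re z + r\<^sup>2"
    unfolding cmod_power2 by (simp add: power2_eq_square algebra_simps)
  have "\<eta> \<le> Re (1 / z) \<longleftrightarrow> \<eta> * (norm z)\<^sup>2 \<le> Re z"
    unfolding Re using z by (simp add: pos_le_divide_eq)
  also have "\<dots> \<longleftrightarrow> (2 * r) * (\<eta> * (norm z)\<^sup>2) \<le> 2 * r * Re z"
    using r by (subst mult_le_cancel_left_pos) auto
  also have "(2 * r) * (\<eta> * (norm z)\<^sup>2) = (norm z)\<^sup>2"
    using r by (simp add: mult.assoc[symmetric])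
  also have "(norm z)\<^sup>2 \<le> 2 * r * Re z \<longleftrightarrow> (norm (of_real r - z))\<^sup>2 \<le> r\<^sup>2"
    unfolding expand by linarith
  also have "\<dots> \<longleftrightarrow> norm (of_real r - z) \<le> r"
    using r by (simp add: power2_le_iff_abs_le)
  finally show "\<eta> \<le> Re (1 / z) \<longleftrightarrow> norm (of_real (1 / (2 * \<eta>)) - z) \<le> 1 / (2 * \<eta>)"
    unfolding r_def .
  have "\<eta> < Re (1 / z) \<longleftrightarrow> \<eta> * (norm z)\<^sup>2 < Re z"
    unfolding Re using z by (simp add: pos_less_divide_eq)
  also have "\<dots> \<longleftrightarrow> (2 * r) * (\<eta> * (norm z)\<^sup>2) < 2 * r * Re z"
    using r by (subst mult_less_cancel_left_pos) auto
  also have "(2 * r) * (\<eta> * (norm z)\<^sup>2) = (norm z)\<^sup>2"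
    using r by (simp add: mult.assoc[symmetric])
  also have "(norm z)\<^sup>2 < 2 * r * Re z \<longleftrightarrow> (norm (of_real r - z))\<^sup>2 < r\<^sup>2"
    unfolding expand by linarith
  also have "\<dots> \<longleftrightarrow> norm (of_real r - z) < r"
    using r by (smt (verit) norm_ge_zero power2_le_imp_le power_mono power_strict_mono zero_less_numeral)
  finally show "\<eta> < Re (1 / z) \<longleftrightarrow> norm (of_real (1 / (2 * \<eta>)) - z) < 1 / (2 * \<eta>)"
    unfolding r_def .
qed

lemma Omega_eq_disc:
  assumes "0 < \<eta>"
  shows "Omega \<eta> = cball (of_real (1 / (2 * \<eta>))) (1 / (2 * \<eta>)) - {0}"
  using Re_inverse_ge_iff(1)[OF assms] by (auto simp: Omega_def dist_norm)

lemma ball_eq_Re_inverse_gt: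
  assumes "0 < \<eta>"
  shows "ball (of_real (1 / (2 * \<eta>))) (1 / (2 * \<eta>)) = {z. z \<noteq> 0 \<and> \<eta> < Re (1 / z)}"
proof -
  have "norm (of_real (1 / (2 * \<eta>)) - z) < 1 / (2 * \<eta>) \<longleftrightarrow> z \<noteq> 0 \<and> \<eta> < Re (1 / z)" for z :: complex
    using Re_inverse_ge_iff(2)[OF assms, of z] assms by (cases "z = 0") (auto simp: norm_divide)
  then show ?thesis
    by (intro set_eqI) (simp only: mem_ball dist_norm mem_Collect_eq)
qed

lemma open_Re_inverse_gt: "0 < \<eta> \<Longrightarrow> open {z::complex. z \<noteq> 0 \<and> \<eta> < Re (1 / z)}"
  unfolding ball_eq_Re_inverse_gt[symmetric] by (rule open_ball)

lemma Omega_all_iff: "z \<in> Omega_all \<longleftrightarrow> z \<noteq> 0 \<and> 1 < Re (1 / z)"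
  unfolding Omega_all_def Omega_def by force

lemma Omega_subset_Omega_all: "1 < \<eta> \<Longrightarrow> Omega \<eta> \<subseteq> Omega_all"
  by (auto simp: Omega_all_def)

lemma norm_le_of_Omega:
  assumes "z \<in> Omega \<eta>" "0 < \<eta>"
  shows "norm z \<le> 1 / \<eta>"
proof -
  have "\<eta> \<le> norm (1 / z)"
    using assms complex_Re_le_cmod[of "1 / z"] by (simp add: Omega_def)
  moreover have "0 < norm z" using assms by (simp add: Omega_def)
  ultimately show ?thesis using assms by (simp add: norm_divide field_simps)
qed

lemma higher_deriv_power_at_0:
  "(deriv ^^ k) (\<lambda>z::complex. z ^ n) 0 = (if k = n then fact n else 0)"
  using higher_deriv_power[of k 0 n 0]
  by (cases k n rule: linorder_cases) (auto simp: pochhammer_0_left pochhammer_fact)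

lemma higher_deriv_polynomial_at_0:
  fixes b :: "nat \<Rightarrow> complex"
  shows "(deriv ^^ k) (\<lambda>z. \<Sum>j<n. b j * z ^ j) 0 = (if k < n then fact k * b k else 0)"
proof (induction n)
  case (Suc n)
  have "(deriv ^^ k) (\<lambda>z. \<Sum>j<Suc n. b j * z ^ j) 0
      = (deriv ^^ k) (\<lambda>z. \<Sum>j<n. b j * z ^ j) 0 + (deriv ^^ k) (\<lambda>z. b n * z ^ n) 0"
    unfolding sum.lessThan_Suc by (rule higher_deriv_add[of _ UNIV]) (auto intro!: holomorphic_intros)
  also have "(deriv ^^ k) (\<lambda>z. b n * z ^ n) 0 = b n * (deriv ^^ k) (\<lambda>z. z ^ n) 0"
    by (rule higher_deriv_cmult[of _ UNIV]) (auto intro!: holomorphic_intros)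
  finally show ?case using Suc by (auto simp: higher_deriv_power_at_0 less_Suc_eq)
qed simp

text \<open>
  Derivatives cost a power of the distance to the boundary, which is comparable to \<open>norm z\<close>
  squared, so \<open>k\<close> derivatives lose \<open>2 * k\<close> powers of \<open>z\<close>. Expanding to order
  \<open>2 * k + 1\<close> leaves one power to spare, and the \<open>k\<close>-th derivative of the Taylor polynomial is
  continuous at 0.
\<close>

lemma asymptotic_expansion_imp_deriv_tendsto:
  fixes b :: "nat \<Rightarrow> complex"
  assumes \<eta>: "1 < \<eta>'" "\<eta>' < \<eta>"
    and hol: "f holomorphic_on {z. z \<noteq> 0 \<and> \<eta>' < Re (1 / z)}"
    and expansion: "\<And>n. \<exists>K. \<forall>z\<in>Omega \<eta>'. norm (f z - (\<Sum>j<n. b j * z ^ j)) \<le> K * norm z ^ n"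
  shows "((deriv ^^ k) f \<longlongrightarrow> fact k * b k) (at 0 within Omega \<eta>)"
proof -
  define S where "S = {z::complex. z \<noteq> 0 \<and> \<eta>' < Re (1 / z)}"
  have S: "open S" unfolding S_def using \<eta> by (intro open_Re_inverse_gt) auto
  have holS: "f holomorphic_on S"
    using hol by (simp only: S_def)
  define P where "P = (\<lambda>z. \<Sum>j<2 * k + 1. b j * z ^ j)"
  have hP: "P holomorphic_on T" for T
    unfolding P_def by (intro holomorphic_intros)
  obtain K where K: "\<And>z. z \<in> Omega \<eta>' \<Longrightarrow> norm (f z - P z) \<le> K * norm z ^ (2 * k + 1)"
    using expansion[of "2 * k + 1"] unfolding P_def by blast
  define \<delta> where "\<delta> = min ((\<eta> - \<eta>') / 4) (1 / 2)"
  have \<delta>: "0 < \<delta>" "\<delta> \<le> 1 / 2" "\<delta> \<le> (\<eta> - \<eta>') / 4"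
    unfolding \<delta>_def using \<eta> by (auto simp only: min.cobounded1 min.cobounded2) auto
  \<comment> \<open>In the coordinate \<open>1 / z\<close> the distance from \<open>Omega \<eta>\<close> to the boundary of \<open>Omega \<eta>'\<close>
    is bounded below, so in the coordinate \<open>z\<close> there is room for a disc of radius
    comparable to \<open>norm z\<close> squared.\<close>
  have disc: "u \<in> S \<and> norm u \<le> 2 * norm z"
    if z: "z \<in> Omega \<eta>" and u: "norm (z - u) \<le> \<delta> * (norm z)\<^sup>2" for z u
  proof -
    have z0: "0 < norm z" using z by (simp add: Omega_def)
    have z1: "norm z \<le> 1"
      using norm_le_of_Omega[OF z] \<eta> by (auto intro: order_trans)
    have "\<delta> * (norm z)\<^sup>2 \<le> (1 / 2) * norm z"
      unfolding power2_eq_square mult.assoc[symmetric]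
      using \<delta> z0 z1 mult_mono[of \<delta> "1 / 2" "norm z" 1] by (intro mult_right_mono) auto
    then have uz: "norm z / 2 \<le> norm u" "norm u \<le> 2 * norm z"
      using u norm_triangle_ineq2[of z u] norm_triangle_ineq3[of z u] by auto
    then have u0: "u \<noteq> 0" using z0 by auto
    have "1 / z - 1 / u = (u - z) / (z * u)"
      using z0 u0 by (simp add: diff_frac_eq)
    then have "norm (1 / z - 1 / u) = norm (z - u) / (norm z * norm u)"
      by (simp only: norm_divide norm_mult norm_minus_commute[of u z])
    also have "\<dots> \<le> (\<delta> * (norm z)\<^sup>2) / (norm z * (norm z / 2))"
      using u uz z0 \<delta> by (intro frac_le mult_left_mono) auto
    also have "\<dots> = 2 * \<delta>"
      using z0 by (simp add: power2_eq_square)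
    finally have "\<bar>Re (1 / z) - Re (1 / u)\<bar> \<le> 2 * \<delta>"
      using abs_Re_le_cmod[of "1 / z - 1 / u"] by simp
    moreover have "\<eta> \<le> Re (1 / z)" using z by (simp add: Omega_def)
    moreover have "\<eta>' < y" if "\<bar>x - y\<bar> \<le> 2 * \<delta>" "\<eta> \<le> x" for x y
      using that \<delta> \<eta> by (simp add: abs_le_iff)
    ultimately have "\<eta>' < Re (1 / u)" by blast
    with u0 uz show ?thesis by (simp add: S_def)
  qed
  define B where "B = fact k * (K * 2 ^ (2 * k + 1)) / \<delta> ^ k"
  have small: "norm ((deriv ^^ k) f z - (deriv ^^ k) P z) \<le> B * norm z" if z: "z \<in> Omega \<eta>" for z
  proof -
    define r where "r = \<delta> * (norm z)\<^sup>2"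
    have z0: "0 < norm z" using z by (simp add: Omega_def)
    then have r: "0 < r" using \<delta> by (simp add: r_def)
    have sub: "cball z r \<subseteq> S"
      using disc[OF z] by (auto simp: r_def dist_norm)
    have K0: "0 \<le> K"
    proof -
      have "z \<in> Omega \<eta>'" using z \<eta> by (simp add: Omega_def)
      from K[OF this] have "0 \<le> K * norm z ^ (2 * k + 1)"
        using norm_ge_zero order_trans by blast
      then show ?thesis
        using zero_less_power[OF z0, of "2 * k + 1"] by (simp only: zero_le_mult_iff) linarith
    qed
    have hd: "(\<lambda>z. f z - P z) holomorphic_on S"
      by (intro holomorphic_intros holS hP)
    have "norm ((deriv ^^ k) (\<lambda>z. f z - P z) z) \<le> fact k * (K * (2 * norm z) ^ (2 * k + 1)) / r ^ k"
    proof (rule Cauchy_inequality[OF _ _ r])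
      show "(\<lambda>z. f z - P z) holomorphic_on ball z r"
        by (rule holomorphic_on_subset[OF hd]) (use sub ball_subset_cball in blast)
      show "continuous_on (cball z r) (\<lambda>z. f z - P z)"
        by (rule holomorphic_on_imp_continuous_on[OF holomorphic_on_subset[OF hd sub]])
      fix u assume "norm (z - u) = r"
      then have u: "u \<in> S" "norm u \<le> 2 * norm z" using disc[OF z, of u] by (auto simp: r_def)
      then have "norm (f u - P u) \<le> K * norm u ^ (2 * k + 1)"
        by (intro K) (auto simp: S_def Omega_def)
      also have "\<dots> \<le> K * (2 * norm z) ^ (2 * k + 1)"
        using u K0 by (intro mult_left_mono power_mono) auto
      finally show "norm (f u - P u) \<le> K * (2 * norm z) ^ (2 * k + 1)" .
    qed
    also have "(deriv ^^ k) (\<lambda>z. f z - P z) z = (deriv ^^ k) f z - (deriv ^^ k) P z"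
      by (rule higher_deriv_diff[OF holS hP S]) (use sub r in auto)
    also have "fact k * (K * (2 * norm z) ^ (2 * k + 1)) / r ^ k = B * norm z"
    proof -
      have "(2 * norm z) ^ (2 * k + 1) = 2 ^ (2 * k + 1) * norm z * ((norm z)\<^sup>2) ^ k"
        by (simp add: power_mult_distrib power_add power_mult)
      moreover have "((norm z)\<^sup>2) ^ k \<noteq> 0" using z0 by simp
      ultimately show ?thesis
        unfolding r_def B_def power_mult_distrib[of \<delta>] using \<delta> by (simp add: field_simps)
    qed
    finally show ?thesis .
  qed
  have "((\<lambda>z. (deriv ^^ k) f z - (deriv ^^ k) P z) \<longlongrightarrow> 0) (at 0 within Omega \<eta>)"
  proof (rule Lim_null_comparison)
    show "\<forall>\<^sub>F z in at 0 within Omega \<eta>. norm ((deriv ^^ k) f z - (deriv ^^ k) P z) \<le> B * norm z"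
      by (auto simp: eventually_at_filter intro!: always_eventually small)
    have "((\<lambda>z. B * norm z) \<longlongrightarrow> B * norm (0::complex)) (at 0 within Omega \<eta>)"
      by (intro tendsto_intros)
    then show "((\<lambda>z. B * norm z) \<longlongrightarrow> 0) (at 0 within Omega \<eta>)" by simp
  qed
  moreover have "((deriv ^^ k) P \<longlongrightarrow> (deriv ^^ k) P 0) (at 0 within Omega \<eta>)"
  proof -
    have "continuous_on UNIV ((deriv ^^ k) P)"
      by (intro holomorphic_on_imp_continuous_on holomorphic_higher_deriv hP) auto
    then show ?thesis
      by (meson UNIV_I continuous_on_def tendsto_within_subset subset_UNIV)
  qed
  ultimately have "((\<lambda>z. ((deriv ^^ k) f z - (deriv ^^ k) P z) + (deriv ^^ k) P z) \<longlongrightarrow> 0 + (deriv ^^ k) P 0) (at 0 within Omega \<eta>)"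
    by (rule tendsto_add)
  moreover have "(deriv ^^ k) P 0 = fact k * b k"
    unfolding P_def higher_deriv_polynomial_at_0 by simp
  ultimately show ?thesis by simp
qed

section \<open>The Laplace transform on the half-line class\<close>

text \<open>
  Each single growth rate \<open>\<zeta> > 1\<close> gives only the smaller half-plane \<open>\<zeta> < Re w\<close>.
\<close>

lemma half_laplace_A_class_holomorphic:
  assumes F: "F \<in> A_class M"
  shows "half_laplace F holomorphic_on {w. 1 < Re w}"
proof -
  have "half_laplace F holomorphic_on (\<Union>\<zeta>\<in>{1<..}. {w. \<zeta> < Re w})"
  proof (rule holomorphic_on_UN_open)
    fix \<zeta> :: real assume "\<zeta> \<in> {1<..}"
    then obtain C where "\<And>n. exp_type (C ^ (n + 1) * M n) \<zeta> (deriv_half n F)"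
      using A_class_exp_type[OF F, of \<zeta>] by auto
    from this[of 0] show "half_laplace F holomorphic_on {w. \<zeta> < Re w}"
      by (auto intro: half_laplace_holomorphic)
  qed (rule open_halfspace_Re_gt)
  moreover have "(\<Union>\<zeta>\<in>{1<..}. {w. \<zeta> < Re w}) = {w. 1 < Re w}"
    using dense by fastforce
  ultimately show ?thesis by simp
qed

lemma laplace_A_class_holomorphic:
  assumes F: "F \<in> A_class M"
  shows "laplace F holomorphic_on Omega_all"
proof -
  have "(\<lambda>z. 1 / z * (half_laplace F \<circ> (\<lambda>z. 1 / z)) z) holomorphic_on Omega_all"
    by (intro holomorphic_intros holomorphic_on_compose_gen[OF _ half_laplace_A_class_holomorphic[OF F]])
       (auto simp: Omega_all_iff)
  then show ?thesis
    by (rule holomorphic_transform) (simp add: laplace_eq_half_laplace)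
qed

lemma laplace_taylor:
  assumes F: "F \<in> A_class M" and z: "z \<in> Omega_all"
  shows "laplace F z = (\<Sum>k<n. deriv_half k F 0 * z ^ k) + z ^ n * (1 / z * half_laplace (deriv_half n F) (1 / z))"
proof (induction n)
  case 0
  show ?case using z by (simp add: laplace_eq_half_laplace)
next
  case (Suc n)
  obtain \<zeta> where \<zeta>: "1 < \<zeta>" "\<zeta> < Re (1 / z)"
    using z dense[of 1 "Re (1 / z)"] by (auto simp: Omega_all_iff)
  obtain C where C: "\<And>n. exp_type (C ^ (n + 1) * M n) \<zeta> (deriv_half n F)"
    using A_class_exp_type[OF F \<zeta>(1)] by auto
  have parts: "1 / z * half_laplace (deriv_half n F) (1 / z) = deriv_half n F 0 + half_laplace (deriv_half (Suc n) F) (1 / z)"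
    by (rule half_laplace_by_parts[OF C C \<zeta>(2) A_class_deriv[OF F]])
  show ?case
    using z unfolding Suc parts by (simp add: Omega_all_iff algebra_simps)
qed

text \<open>
  The transform of the \<open>n\<close>-th derivative is \<open>1 / z\<close> times an integral that is bounded on
  \<open>Omega \<eta>\<close>, but \<open>1 / z\<close> is not. One more integration by parts turns this product into the value of the \<open>n\<close>-th derivative at 0 plus the integral of the next one, at the
  price of \<open>M (n + 1)\<close> in place of \<open>M n\<close>.
\<close>

lemma laplace_remainder_bound:
  assumes reg: "regular_seq M" and F: "F \<in> A_class M" and \<eta>: "1 < \<eta>"
  shows "\<exists>C>0. \<forall>n. \<forall>z\<in>Omega \<eta>.
    norm (laplace F z - (\<Sum>k<n. deriv_half k F 0 * z ^ k)) \<le> C ^ (n + 1) * M n * norm z ^ n"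
proof -
  obtain \<zeta> where \<zeta>: "1 < \<zeta>" "\<zeta> < \<eta>" using dense[OF \<eta>] by blast
  define \<delta> where "\<delta> = \<eta> - \<zeta>"
  have \<delta>: "0 < \<delta>" using \<zeta> by (simp add: \<delta>_def)
  obtain C where C: "0 < C" "\<And>n. exp_type (C ^ (n + 1) * M n) \<zeta> (deriv_half n F)"
    using A_class_exp_type[OF F \<zeta>(1)] by auto
  obtain B where B: "1 \<le> B" "\<And>n. M (Suc n) \<le> B ^ Suc n * M n"
    using regular_seq_derivation_closed[OF reg] by blast
  have pos: "0 < M n" for n using regular_seq_pos[OF reg] .
  \<comment> \<open>The summand \<open>C\<close> accounts for the value at 0, the other one for the integral; the factor
    \<open>1 + C / \<delta>\<close> is at least 1, so that its powers dominate \<open>C / \<delta>\<close>.\<close>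
  define C' where "C' = C + C * B * (1 + C / \<delta>)"
  have C': "0 < C'" using C B \<delta> by (simp add: C'_def add_pos_pos)
  have "norm (laplace F z - (\<Sum>k<n. deriv_half k F 0 * z ^ k)) \<le> C' ^ (n + 1) * M n * norm z ^ n"
    if z: "z \<in> Omega \<eta>" for n z
  proof -
    have zall: "z \<in> Omega_all" using z Omega_subset_Omega_all[OF \<eta>] by blast
    have Re: "\<zeta> < Re (1 / z)" "\<delta> \<le> Re (1 / z) - \<zeta>"
      using z \<zeta> by (auto simp: Omega_def \<delta>_def)
    have parts: "1 / z * half_laplace (deriv_half n F) (1 / z) = deriv_half n F 0 + half_laplace (deriv_half (Suc n) F) (1 / z)"
      by (rule half_laplace_by_parts[OF C(2) C(2) Re(1) A_class_deriv[OF F]])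
    have "norm (deriv_half n F 0) \<le> C ^ (n + 1) * M n"
      using C(2)[of n] by (auto simp: exp_type_def dest!: spec[of _ 0])
    moreover have "norm (half_laplace (deriv_half (Suc n) F) (1 / z)) \<le> C ^ (n + 1) * B ^ (n + 1) * (C / \<delta>) * M n"
    proof -
      have "norm (half_laplace (deriv_half (Suc n) F) (1 / z)) \<le> C ^ (Suc n + 1) * M (Suc n) / (Re (1 / z) - \<zeta>)"
        by (rule half_laplace_bound[OF C(2) Re(1)])
      also have "\<dots> \<le> C ^ (Suc n + 1) * (B ^ Suc n * M n) / \<delta>"
        using C(1) B pos \<delta> Re by (intro frac_le mult_left_mono mult_nonneg_nonneg) (auto simp: less_imp_le)
      finally show ?thesis by (simp add: field_simps)
    qed
    ultimately have "norm (deriv_half n F 0 + half_laplace (deriv_half (Suc n) F) (1 / z))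
        \<le> (C ^ (n + 1) + (C * B) ^ (n + 1) * (C / \<delta>)) * M n"
      using norm_triangle_ineq[of "deriv_half n F 0" "half_laplace (deriv_half (Suc n) F) (1 / z)"]
      by (simp add: algebra_simps power_mult_distrib)
    also have "\<dots> \<le> C' ^ (n + 1) * M n"
    proof (rule mult_right_mono)
      have "C / \<delta> \<le> (1 + C / \<delta>) ^ 1" by simp
      also have "\<dots> \<le> (1 + C / \<delta>) ^ (n + 1)"
        using C(1) \<delta> by (intro power_increasing) auto
      finally have "(C * B) ^ (n + 1) * (C / \<delta>) \<le> (C * B) ^ (n + 1) * (1 + C / \<delta>) ^ (n + 1)"
        using C(1) B(1) by (intro mult_left_mono) auto
      also have "\<dots> = (C * B * (1 + C / \<delta>)) ^ (n + 1)"
        by (simp only: power_mult_distrib)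
      finally have "C ^ (n + 1) + (C * B) ^ (n + 1) * (C / \<delta>) \<le> C ^ (n + 1) + (C * B * (1 + C / \<delta>)) ^ (n + 1)"
        by simp
      also have "\<dots> \<le> C' ^ (n + 1)"
        unfolding C'_def using power_Suc_superadditive[of C "C * B * (1 + C / \<delta>)" n] C(1) B(1) \<delta> by simp
      finally show "C ^ (n + 1) + (C * B) ^ (n + 1) * (C / \<delta>) \<le> C' ^ (n + 1)" .
    qed (use pos[of n] in simp)
    finally have "norm z ^ n * norm (deriv_half n F 0 + half_laplace (deriv_half (Suc n) F) (1 / z)) \<le> norm z ^ n * (C' ^ (n + 1) * M n)"
      by (intro mult_left_mono) auto
    moreover have "laplace F z - (\<Sum>k<n. deriv_half k F 0 * z ^ k)
        = z ^ n * (deriv_half n F 0 + half_laplace (deriv_half (Suc n) F) (1 / z))"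
      unfolding laplace_taylor[OF F zall, of n] parts by simp
    ultimately show ?thesis by (simp add: norm_mult norm_power mult_ac)
  qed
  with C' show ?thesis by blast
qed

lemma laplace_in_D_class:
  assumes reg: "regular_seq M" and F: "F \<in> A_class M"
  shows "laplace F \<in> D_class M"
proof -
  define c where "c = (\<lambda>k. fact k * deriv_half k F 0)"
  have c: "c k / fact k = deriv_half k F 0" for k
    by (simp add: c_def)
  have "((deriv ^^ k) (laplace F) \<longlongrightarrow> c k) (at 0 within Omega \<eta>)" if \<eta>: "1 < \<eta>" for k \<eta>
  proof -
    obtain \<zeta> where \<zeta>: "1 < \<zeta>" "\<zeta> < \<eta>" using dense[OF \<eta>] by blast
    show ?thesis
      unfolding c_def
    proof (rule asymptotic_expansion_imp_deriv_tendsto[OF \<zeta>])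
      show "laplace F holomorphic_on {z. z \<noteq> 0 \<and> \<zeta> < Re (1 / z)}"
        by (rule holomorphic_on_subset[OF laplace_A_class_holomorphic[OF F]])
           (use \<zeta> in \<open>auto simp: Omega_all_iff\<close>)
      show "\<exists>K. \<forall>z\<in>Omega \<zeta>. norm (laplace F z - (\<Sum>j<n. deriv_half j F 0 * z ^ j)) \<le> K * norm z ^ n" for n
        using laplace_remainder_bound[OF reg F \<zeta>(1)] by blast
    qed
  qed
  moreover have "laplace F z = 0" if "z \<notin> Omega_all" for z
    using that by (simp add: laplace_def)
  moreover have "laplace F holomorphic_on Omega \<eta>" if "1 < \<eta>" for \<eta>
    by (rule holomorphic_on_subset[OF laplace_A_class_holomorphic[OF F] Omega_subset_Omega_all[OF that]])
  ultimately show ?thesis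
    using laplace_remainder_bound[OF reg F] unfolding D_class_def mem_Collect_eq c[symmetric] by blast
qed

section \<open>Inversion of the Laplace transform\<close>

lemma half_laplace_const:
  assumes "0 < Re w"
  shows "half_laplace (\<lambda>_. c) w = c / w"
proof -
  have "w * half_laplace (\<lambda>_. c) w = c + half_laplace (\<lambda>_. 0) w"
    by (rule half_laplace_by_parts[where K = "norm c" and K' = 0 and \<eta> = 0])
       (use assms in \<open>auto simp: exp_type_def\<close>)
  moreover have "half_laplace (\<lambda>_. 0) w = 0"
    by (simp add: half_laplace_def)
  moreover have "w \<noteq> 0" using assms by auto
  ultimately show ?thesis by (simp add: field_simps)
qed

lemma half_laplace_affine:
  assumes "0 \<le> \<eta>" "\<eta> < Re w" "exp_type K \<eta> (\<lambda>t. b0 + b1 * of_real t)"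
  shows "w * half_laplace (\<lambda>t. b0 + b1 * of_real t) w = b0 + b1 / w"
proof -
  have "exp_type (norm b1) \<eta> (\<lambda>_. b1)"
  proof -
    have "norm b1 * 1 \<le> norm b1 * exp (\<eta> * t)" if "0 \<le> t" for t
      using that assms(1) by (intro mult_left_mono) auto
    then show ?thesis by (simp add: exp_type_def)
  qed
  then have "w * half_laplace (\<lambda>t. b0 + b1 * of_real t) w = (b0 + b1 * of_real 0) + half_laplace (\<lambda>_. b1) w"
    by (intro half_laplace_by_parts[OF assms(3) _ assms(2)]) (auto intro!: derivative_eq_intros)
  then show ?thesis using half_laplace_const[of w b1] assms by simp
qed

text \<open>
  The rate \<open>\<eta> + 1\<close> is a convenient one for the primitive: \<open>t * exp (\<eta> * t)\<close> is at most
  \<open>exp ((\<eta> + 1) * t)\<close>.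
\<close>

lemma exp_type_primitive:
  assumes H: "exp_type K \<eta> H" and \<eta>: "0 \<le> \<eta>"
  shows "exp_type (norm b + K) (\<eta> + 1) (\<lambda>t. b + integral {0..t} H)"
    and "0 \<le> t \<Longrightarrow> ((\<lambda>t. b + integral {0..t} H) has_vector_derivative H t) (at t within {0..})"
    and "\<eta> + 1 < Re w \<Longrightarrow> w * half_laplace (\<lambda>t. b + integral {0..t} H) w = b + half_laplace H w"
proof -
  have cont: "continuous_on {0..t} H" for t
    using H by (auto simp: exp_type_def intro: continuous_on_subset)
  have K0: "0 \<le> K" by (rule exp_type_K_nonneg[OF H])
  have deriv: "((\<lambda>t. b + integral {0..t} H) has_vector_derivative H t) (at t within {0..})" if "0 \<le> t" for t
  proof -
    have "((\<lambda>t. integral {0..t} H) has_vector_derivative H t) (at t within {0..t + 1})"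
      by (rule integral_has_vector_derivative[OF cont]) (use that in auto)
    moreover have "at t within {0..t + 1} = at t within {0..}"
      by (rule at_within_nhd[of _ "{..<t + 1}"]) auto
    ultimately have "((\<lambda>t. integral {0..t} H) has_vector_derivative H t) (at t within {0..})"
      by simp
    then show ?thesis
      using has_vector_derivative_add[OF has_vector_derivative_const[of b]] by fastforce
  qed
  show "0 \<le> t \<Longrightarrow> ((\<lambda>t. b + integral {0..t} H) has_vector_derivative H t) (at t within {0..})"
    by (rule deriv)
  show I: "exp_type (norm b + K) (\<eta> + 1) (\<lambda>t. b + integral {0..t} H)"
    unfolding exp_type_def
  proof (intro conjI allI impI)
    show "continuous_on {0..} (\<lambda>t. b + integral {0..t} H)"
      by (rule continuous_on_vector_derivative) (use deriv in auto)
    fix t :: real assume t: "0 \<le> t"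
    have "norm (integral {0..t} H) \<le> (K * exp (\<eta> * t)) * (t - 0)"
    proof (rule integral_bound[OF t cont])
      fix s assume s: "s \<in> {0..t}"
      have "K * exp (\<eta> * s) \<le> K * exp (\<eta> * t)"
        using s \<eta> K0 by (intro mult_left_mono) (auto intro: mult_left_mono)
      then show "norm (H s) \<le> K * exp (\<eta> * t)"
        using H s by (auto simp: exp_type_def intro: order_trans)
    qed
    also have "\<dots> \<le> (K * exp (\<eta> * t)) * exp t"
    proof (rule mult_left_mono)
      show "t - 0 \<le> exp t" using exp_ge_add_one_self[of t] by linarith
    qed (use K0 in simp)
    also have "\<dots> = K * exp ((\<eta> + 1) * t)"
      by (simp add: algebra_simps exp_add)
    finally have "norm (b + integral {0..t} H) \<le> norm b * 1 + K * exp ((\<eta> + 1) * t)"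
      using norm_triangle_ineq[of b "integral {0..t} H"] by linarith
    also have "\<dots> \<le> norm b * exp ((\<eta> + 1) * t) + K * exp ((\<eta> + 1) * t)"
      using t \<eta> by (intro add_right_mono mult_left_mono) auto
    finally show "norm (b + integral {0..t} H) \<le> (norm b + K) * exp ((\<eta> + 1) * t)"
      by (simp add: algebra_simps)
  qed
  show "\<eta> + 1 < Re w \<Longrightarrow> w * half_laplace (\<lambda>t. b + integral {0..t} H) w = b + half_laplace H w"
    using half_laplace_by_parts[OF I exp_type_mono[OF H], of w] deriv by simp
qed

text \<open>
  Bromwich's integral over the line \<open>Re u = \<eta>\<close> becomes, with \<open>u = 1 / z\<close>, the integral of
  \<open>R z / z * exp (t / z)\<close> over the circle \<open>\<gamma>\<close>. There \<open>norm (exp (t / z)) = exp (\<eta> * t)\<close> away from 0,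
  and \<open>R z / z\<close> is bounded and tends to 0 at the origin, so the integral over the circle converges
  absolutely. Integrating over \<open>t\<close> first replaces \<open>exp (t / z)\<close> by \<open>1 / (w - 1 / z)\<close>, and what
  remains is Cauchy's integral of \<open>R\<close> at the interior point \<open>1 / w\<close>.
\<close>

lemma laplace_inversion_on_circle:
  fixes R :: "complex \<Rightarrow> complex"
  assumes \<eta>: "1 < \<eta>" and hol: "R holomorphic_on Omega \<eta>"
    and bound: "\<And>z. z \<in> Omega \<eta> \<Longrightarrow> norm (R z) \<le> K * norm z ^ 2"
  obtains G where "exp_type K \<eta> G" "\<And>w. \<eta> < Re w \<Longrightarrow> w * half_laplace G w = R (1 / w)"
proof -
  define r where "r = 1 / (2 * \<eta>)"
  have r: "0 < r" "2 * r \<le> 1" using \<eta> by (simp_all add: r_def)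
  have Omega: "Omega \<eta> = cball (of_real r) r - {0}"
    unfolding r_def using \<eta> by (intro Omega_eq_disc) auto
  have norm_le_1: "norm z \<le> 1" if "z \<in> Omega \<eta>" for z
    using norm_le_of_Omega[OF that] \<eta> by (auto intro: order_trans)
  have K0: "0 \<le> K"
  proof -
    have "of_real (1 / \<eta>) \<in> Omega \<eta>" using \<eta> by (simp add: Omega_def)
    from bound[OF this] have "0 \<le> K * norm (complex_of_real (1 / \<eta>)) ^ 2"
      using norm_ge_zero order_trans by blast
    then show ?thesis using \<eta> by (simp add: zero_le_mult_iff)
  qed
  \<comment> \<open>\<open>R\<close> is extended by its limit 0 to the boundary point 0, to obtain a function that is
    continuous on the closed disc.\<close>
  define R0 where "R0 = (\<lambda>z. if z = 0 then 0 else R z)"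
  have R0_bound: "norm (R0 z) \<le> K * norm z ^ 2" if "z \<in> cball (of_real r) r" for z
    using bound[of z] that by (auto simp: R0_def Omega)
  have R0_cont: "continuous_on (cball (of_real r) r) R0"
    unfolding continuous_on_def
  proof
    fix z :: complex assume z: "z \<in> cball (of_real r) r"
    show "(R0 \<longlongrightarrow> R0 z) (at z within cball (of_real r) r)"
    proof (cases "z = 0")
      case True
      have "((\<lambda>u. K * norm u ^ 2) \<longlongrightarrow> K * norm (0::complex) ^ 2) (at (0::complex) within cball (of_real r) r)"
        by (intro tendsto_intros)
      then have lim: "((\<lambda>u. K * norm u ^ 2) \<longlongrightarrow> 0) (at (0::complex) within cball (of_real r) r)"
        by simp
      have "\<forall>\<^sub>F u in at 0 within cball (of_real r) r. norm (R0 u) \<le> K * norm u ^ 2"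
        using R0_bound by (auto simp: eventually_at_filter intro!: always_eventually)
      then have "(R0 \<longlongrightarrow> 0) (at 0 within cball (of_real r) r)"
        using lim by (rule Lim_null_comparison)
      then show ?thesis using True by (simp add: R0_def)
    next
      case False
      have "(R \<longlongrightarrow> R z) (at z within Omega \<eta>)"
        using holomorphic_on_imp_continuous_on[OF hol] z False by (auto simp: continuous_on_def Omega)
      then have "(R0 \<longlongrightarrow> R z) (at z within Omega \<eta>)"
        by (rule Lim_transform_eventually)
           (auto simp: R0_def Omega eventually_at_filter intro!: always_eventually)
      moreover have "\<forall>\<^sub>F u in at z. u \<in> Omega \<eta> \<longleftrightarrow> u \<in> cball (of_real r) r"
        using t1_space_nhds[OF False] by (auto simp: Omega eventually_at_filter elim!: eventually_mono)
      ultimately have "(R0 \<longlongrightarrow> R z) (at z within cball (of_real r) r)"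
        by (rule Lim_transform_within_set)
      then show ?thesis using False by (simp add: R0_def)
    qed
  qed
  have R0_hol: "R0 holomorphic_on ball (of_real r) r"
  proof (rule holomorphic_transform)
    have "ball (of_real r) r \<subseteq> Omega \<eta>"
      using r by (auto simp: Omega)
    then show "R holomorphic_on ball (of_real r) r"
      using hol holomorphic_on_subset by blast
    show "R z = R0 z" if "z \<in> ball (of_real r) r" for z
      using that r by (auto simp: R0_def)
  qed
  define \<gamma> where "\<gamma> = circlepath (of_real r) r"
  have \<gamma>: "\<gamma> = (\<lambda>\<theta>. of_real r + of_real r * exp (2 * of_real pi * \<i> * of_real \<theta>))"
    by (simp add: \<gamma>_def circlepath)
  have \<gamma>_cont: "continuous_on S \<gamma>" for S
    unfolding \<gamma> by (intro continuous_intros)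
  have \<gamma>_sphere: "norm (of_real r - \<gamma> \<theta>) = r" for \<theta>
    using r by (simp add: \<gamma> norm_mult)
  then have \<gamma>_cball: "\<gamma> \<theta> \<in> cball (of_real r) r" for \<theta>
    by (simp add: dist_norm)
  have \<gamma>_Re: "Re (1 / \<gamma> \<theta>) = \<eta>" if "\<gamma> \<theta> \<noteq> 0" for \<theta>
    using Re_inverse_ge_iff[of \<eta> "\<gamma> \<theta>"] \<gamma>_sphere[of \<theta>] \<eta> that unfolding r_def
    by (metis linorder_not_le order.strict_trans less_irrefl less_numeral_extra(1) order_antisym order_refl)
  \<comment> \<open>\<open>\<psi> \<theta> d\<theta>\<close> is \<open>R z / z dz\<close> divided by \<open>2 * pi * \<i>\<close>. At the parameter where
    \<open>\<gamma> \<theta> = 0\<close>, division by 0 gives the correct limit 0.\<close>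
  define \<psi> where "\<psi> = (\<lambda>\<theta>. (indicator {0..1} \<theta> *\<^sub>R R0 (\<gamma> \<theta>)) / \<gamma> \<theta> * (of_real r * exp (2 * of_real pi * \<i> * of_real \<theta>)))"
  have \<psi>_meas [measurable]: "\<psi> \<in> borel_measurable borel"
  proof -
    have [measurable]: "(\<lambda>\<theta>. indicator {0..1} \<theta> *\<^sub>R R0 (\<gamma> \<theta>)) \<in> borel_measurable borel"
      using \<gamma>_cball
      by (intro borel_measurable_continuous_on_indicator continuous_on_compose2[OF R0_cont \<gamma>_cont]) auto
    have [measurable]: "\<gamma> \<in> borel_measurable borel"
      by (intro borel_measurable_continuous_onI \<gamma>_cont)
    have [measurable]: "(\<lambda>\<theta>. exp (2 * of_real pi * \<i> * complex_of_real \<theta>)) \<in> borel_measurable borel"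
      by (intro borel_measurable_continuous_onI continuous_intros)
    show ?thesis unfolding \<psi>_def by measurable
  qed
  have \<gamma>_meas [measurable]: "\<gamma> \<in> borel_measurable borel"
    by (intro borel_measurable_continuous_onI \<gamma>_cont)
  have \<psi>_0: "\<psi> \<theta> = 0" if "\<gamma> \<theta> = 0" for \<theta>
    using that by (simp add: \<psi>_def)
  have \<psi>_bound: "norm (\<psi> \<theta>) \<le> K * indicator {0..1} \<theta>" for \<theta>
  proof (cases "\<gamma> \<theta> = 0")
    case False
    have "norm (R0 (\<gamma> \<theta>)) / norm (\<gamma> \<theta>) * r \<le> (K * norm (\<gamma> \<theta>) ^ 2) / norm (\<gamma> \<theta>) * r"
      using R0_bound[OF \<gamma>_cball] r by (intro mult_right_mono divide_right_mono) auto
    also have "\<dots> = K * (norm (\<gamma> \<theta>) * r)"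
      using False by (simp add: power2_eq_square)
    also have "\<dots> \<le> K * (1 * 1)"
      using K0 r norm_le_1[of "\<gamma> \<theta>"] \<gamma>_cball[of \<theta>] False by (intro mult_left_mono mult_mono) (auto simp: Omega)
    finally show ?thesis
      using r by (auto simp: \<psi>_def norm_mult norm_divide indicator_def)
  qed (use K0 \<psi>_0 in simp)
  have kernel_bound: "norm (\<psi> \<theta> * exp (of_real t / \<gamma> \<theta>)) \<le> K * indicator {0..1} \<theta> * exp (\<eta> * t)" for \<theta> t
  proof (cases "\<gamma> \<theta> = 0")
    case False
    have "Re (of_real t / \<gamma> \<theta>) = t * Re (1 / \<gamma> \<theta>)"
      by (simp add: Re_divide)
    with \<gamma>_Re[OF False] have "Re (of_real t / \<gamma> \<theta>) = \<eta> * t" by simp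
    then show ?thesis
      using \<psi>_bound[of \<theta>] by (auto simp: norm_mult intro!: mult_right_mono)
  qed (use K0 \<psi>_0 in simp)
  have ind_int: "integrable lborel (\<lambda>\<theta>. K * indicator {0..1::real} \<theta> * c)" for c
    by simp
  define G where "G = (\<lambda>t::real. LINT \<theta>|lborel. \<psi> \<theta> * exp (of_real t / \<gamma> \<theta>))"
  have kernel_int: "integrable lborel (\<lambda>\<theta>. \<psi> \<theta> * exp (of_real t / \<gamma> \<theta>))" for t
    by (rule Bochner_Integration.integrable_bound[OF ind_int[of "exp (\<eta> * t)"]])
       (use kernel_bound[of _ t] K0 in \<open>auto intro!: AE_I2 simp: abs_mult\<close>)
  have G_type: "exp_type K \<eta> G"
    unfolding exp_type_def
  proof (intro conjI allI impI)
    show "norm (G t) \<le> K * exp (\<eta> * t)" for t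
    proof -
      have "norm (G t) \<le> (LINT \<theta>|lborel. K * indicator {0..1::real} \<theta> * exp (\<eta> * t))"
        unfolding G_def using kernel_int ind_int kernel_bound by (rule Bochner_Integration.integral_norm_bound_integral)
      then show ?thesis by simp
    qed
    show "continuous_on {0..} G"
      unfolding continuous_on_sequentially comp_def
    proof (intro allI ballI impI)
      fix x and t :: real
      assume "t \<in> {0..}" and x: "(\<forall>n. x n \<in> {0..}) \<and> x \<longlonglongrightarrow> t"
      then obtain B where B: "\<And>n. \<bar>x n\<bar> \<le> B"
        using convergent_imp_Bseq[of x] by (auto simp: convergent_def Bseq_def)
      show "(\<lambda>n. G (x n)) \<longlonglongrightarrow> G t"
        unfolding G_def
      proof (rule integral_dominated_convergence[OF _ _ ind_int[of "exp (\<eta> * B)"]])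
        show "AE \<theta> in lborel. (\<lambda>n. \<psi> \<theta> * exp (of_real (x n) / \<gamma> \<theta>)) \<longlonglongrightarrow> \<psi> \<theta> * exp (of_real t / \<gamma> \<theta>)"
        proof (rule AE_I2)
          fix \<theta> :: real show "(\<lambda>n. \<psi> \<theta> * exp (of_real (x n) / \<gamma> \<theta>)) \<longlonglongrightarrow> \<psi> \<theta> * exp (of_real t / \<gamma> \<theta>)"
          proof (cases "\<gamma> \<theta> = 0")
            case False
            then show ?thesis using x by (intro tendsto_intros) auto
          qed (simp add: \<psi>_0)
        qed
        show "AE \<theta> in lborel. norm (\<psi> \<theta> * exp (of_real (x n) / \<gamma> \<theta>)) \<le> K * indicator {0..1} \<theta> * exp (\<eta> * B)" for n
        proof (rule AE_I2)
          fix \<theta> :: real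
          have "\<eta> * x n \<le> \<eta> * B" using B[of n] \<eta> by (intro mult_left_mono) auto
          then have "K * indicator {0..1} \<theta> * exp (\<eta> * x n) \<le> K * indicator {0..1} \<theta> * exp (\<eta> * B)"
            using K0 by (intro mult_left_mono) auto
          then show "norm (\<psi> \<theta> * exp (of_real (x n) / \<gamma> \<theta>)) \<le> K * indicator {0..1} \<theta> * exp (\<eta> * B)"
            using kernel_bound[of \<theta> "x n"] by linarith
        qed
      qed auto
    qed
  qed
  have "w * half_laplace G w = R (1 / w)" if w: "\<eta> < Re w" for w
  proof -
    have w0: "w \<noteq> 0" using w \<eta> by auto
    define h where "h = (\<lambda>(t::real) \<theta>. indicator {0..} t *\<^sub>R (\<psi> \<theta> * exp (of_real t / \<gamma> \<theta>) * exp (- (of_real t * w))))"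
    have h_bound: "norm (h t \<theta>) \<le> K * indicator {0..1} \<theta> * (indicator {0..} t *\<^sub>R exp (- (Re w - \<eta>) * t))" for t \<theta>
    proof -
      have "norm (h t \<theta>) = indicator {0..} t * (norm (\<psi> \<theta> * exp (of_real t / \<gamma> \<theta>)) * exp (- (t * Re w)))"
        by (simp add: h_def norm_mult)
      also have "\<dots> \<le> indicator {0..} t * (K * indicator {0..1} \<theta> * exp (\<eta> * t) * exp (- (t * Re w)))"
        by (intro mult_left_mono mult_right_mono kernel_bound) auto
      also have "exp (\<eta> * t) * exp (- (t * Re w)) = exp (- (Re w - \<eta>) * t)"
        by (simp add: algebra_simps flip: exp_add)
      then have "indicator {0..} t * (K * indicator {0..1} \<theta> * exp (\<eta> * t) * exp (- (t * Re w)))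
          = K * indicator {0..1} \<theta> * (indicator {0..} t *\<^sub>R exp (- (Re w - \<eta>) * t))"
        by (simp add: mult_ac)
      finally show ?thesis .
    qed
    have h_meas [measurable]: "case_prod h \<in> borel_measurable (lborel \<Otimes>\<^sub>M lborel)"
      unfolding h_def by measurable
    have decay_int: "integrable lborel (\<lambda>t. indicator {0..} t *\<^sub>R exp (- (Re w - \<eta>) * t))"
      using exp_decay_integral(1)[of "Re w - \<eta>" 0] w by (simp add: set_integrable_def)
    have h_int: "integrable lborel (h t)" for t
    proof (rule Bochner_Integration.integrable_bound[OF ind_int[of "indicator {0..} t *\<^sub>R exp (- (Re w - \<eta>) * t)"]])
      show "h t \<in> borel_measurable lborel"
        unfolding h_def by measurable
      show "AE \<theta> in lborel. norm (h t \<theta>)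
          \<le> norm (K * indicator {0..1} \<theta> * (indicator {0..} t *\<^sub>R exp (- (Re w - \<eta>) * t)))"
        by (rule AE_I2, rule order_trans[OF h_bound]) simp
    qed
    have "integrable (lborel \<Otimes>\<^sub>M lborel) (case_prod h)"
    proof (rule lborel_pair.Fubini_integrable)
      show "AE t in lborel. integrable lborel (\<lambda>\<theta>. case_prod h (t, \<theta>))"
        using h_int by simp
      show "integrable lborel (\<lambda>t. LINT \<theta>|lborel. norm (case_prod h (t, \<theta>)))"
      proof (rule Bochner_Integration.integrable_bound)
        show "integrable lborel (\<lambda>t. K * (indicator {0..} t *\<^sub>R exp (- (Re w - \<eta>) * t)))"
          using decay_int by (rule integrable_mult_right)
        show "AE t in lborel. norm (LINT \<theta>|lborel. norm (case_prod h (t, \<theta>)))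
            \<le> norm (K * (indicator {0..} t *\<^sub>R exp (- (Re w - \<eta>) * t)))"
        proof (rule AE_I2)
          fix t :: real
          have "norm (LINT \<theta>|lborel. norm (h t \<theta>))
              \<le> (LINT \<theta>|lborel. K * indicator {0..1::real} \<theta> * (indicator {0..} t *\<^sub>R exp (- (Re w - \<eta>) * t)))"
          proof (rule Bochner_Integration.integral_norm_bound_integral[OF _ ind_int])
            show "integrable lborel (\<lambda>\<theta>. norm (h t \<theta>))"
              using h_int by (rule integrable_norm)
          qed (use h_bound in auto)
          then show "norm (LINT \<theta>|lborel. norm (case_prod h (t, \<theta>)))
              \<le> norm (K * (indicator {0..} t *\<^sub>R exp (- (Re w - \<eta>) * t)))"
            using K0 by (simp add: abs_mult)
        qed
      qed measurable
    qed measurable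
    then have swap: "(LINT t|lborel. LINT \<theta>|lborel. h t \<theta>) = (LINT \<theta>|lborel. LINT t|lborel. h t \<theta>)"
      by (rule lborel_pair.Fubini_integral[symmetric])
    have "half_laplace G w = (LINT t|lborel. LINT \<theta>|lborel. h t \<theta>)"
      unfolding half_laplace_def set_lebesgue_integral_def
    proof (intro Bochner_Integration.integral_cong refl)
      fix t :: real
      show "indicator {0..} t *\<^sub>R (G t * exp (- (of_real t * w))) = (LINT \<theta>|lborel. h t \<theta>)"
        unfolding G_def h_def by (simp only: Bochner_Integration.integral_scaleR_right Bochner_Integration.integral_mult_left_zero)
    qed
    also note swap
    also have "(LINT \<theta>|lborel. LINT t|lborel. h t \<theta>)
        = (LINT \<theta>|lborel. indicator {0..1} \<theta> *\<^sub>R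
            (R0 (\<gamma> \<theta>) / (\<gamma> \<theta> - 1 / w) * vector_derivative \<gamma> (at \<theta>) * (1 / (2 * of_real pi * \<i> * w))))"
    proof (intro Bochner_Integration.integral_cong refl)
      fix \<theta> :: real
      show "(LINT t|lborel. h t \<theta>) = indicator {0..1} \<theta> *\<^sub>R
          (R0 (\<gamma> \<theta>) / (\<gamma> \<theta> - 1 / w) * vector_derivative \<gamma> (at \<theta>) * (1 / (2 * of_real pi * \<i> * w)))"
      proof (cases "\<gamma> \<theta> = 0")
        case True
        then show ?thesis by (simp add: h_def \<psi>_0 R0_def)
      next
        case False
        have Re: "0 < Re (w - 1 / \<gamma> \<theta>)" using \<gamma>_Re[OF False] w by simp
        then have ne: "w - 1 / \<gamma> \<theta> \<noteq> 0" by auto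
        have "h t \<theta> = \<psi> \<theta> * (indicator {0..} t *\<^sub>R (1 * exp (- (of_real t * (w - 1 / \<gamma> \<theta>)))))" for t
          by (simp add: h_def algebra_simps exp_diff exp_minus field_simps)
        then have "(LINT t|lborel. h t \<theta>) = \<psi> \<theta> * half_laplace (\<lambda>_. 1) (w - 1 / \<gamma> \<theta>)"
          by (simp only: half_laplace_def set_lebesgue_integral_def Bochner_Integration.integral_mult_right_zero)
        also have "\<dots> = \<psi> \<theta> / (w - 1 / \<gamma> \<theta>)"
          using half_laplace_const[OF Re, of 1] by simp
        also have "\<dots> = indicator {0..1} \<theta> *\<^sub>R
            (R0 (\<gamma> \<theta>) / (\<gamma> \<theta> - 1 / w) * vector_derivative \<gamma> (at \<theta>) * (1 / (2 * of_real pi * \<i> * w)))"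
        proof -
          have "\<gamma> \<theta> * (w - 1 / \<gamma> \<theta>) = w * (\<gamma> \<theta> - 1 / w)"
            using False w0 by (simp add: field_simps)
          then show ?thesis
            unfolding \<psi>_def \<gamma>_def[symmetric] vector_derivative_circlepath[of "of_real r" r \<theta>, folded \<gamma>_def]
            by (simp add: scaleR_conv_of_real mult_ac)
        qed
        finally show ?thesis .
      qed
    qed
    also have "\<dots> = (LINT \<theta>:{0..1}|lborel. R0 (\<gamma> \<theta>) / (\<gamma> \<theta> - 1 / w) * vector_derivative \<gamma> (at \<theta>)) * (1 / (2 * of_real pi * \<i> * w))"
      unfolding set_lebesgue_integral_def[symmetric] by (rule set_integral_mult_left)
    also have "(LINT \<theta>:{0..1}|lborel. R0 (\<gamma> \<theta>) / (\<gamma> \<theta> - 1 / w) * vector_derivative \<gamma> (at \<theta>)) = 2 * of_real pi * \<i> * R0 (1 / w)"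
    proof -
      have inside: "norm (1 / w - of_real r) < r"
      proof -
        have "1 / w \<in> ball (of_real r) r"
          unfolding r_def using ball_eq_Re_inverse_gt[of \<eta>] \<eta> w w0 by auto
        then show ?thesis by (simp add: dist_norm norm_minus_commute)
      qed
      have ne: "\<gamma> \<theta> - 1 / w \<noteq> 0" for \<theta>
        using \<gamma>_sphere[of \<theta>] inside by (auto simp: norm_minus_commute)
      have "((\<lambda>u. R0 u / (u - 1 / w)) has_contour_integral (2 * of_real pi * \<i> * R0 (1 / w))) \<gamma>"
        unfolding \<gamma>_def by (rule Cauchy_integral_circlepath[OF R0_cont R0_hol inside])
      then have hi: "((\<lambda>\<theta>. R0 (\<gamma> \<theta>) / (\<gamma> \<theta> - 1 / w) * vector_derivative \<gamma> (at \<theta>)) has_integral (2 * of_real pi * \<i> * R0 (1 / w))) {0..1}"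
        by (simp add: has_contour_integral)
      have "set_integrable lborel {0..1} (\<lambda>\<theta>. R0 (\<gamma> \<theta>) / (\<gamma> \<theta> - 1 / w) * vector_derivative \<gamma> (at \<theta>))"
        unfolding \<gamma>_def vector_derivative_circlepath unfolding \<gamma>_def[symmetric]
        by (rule borel_integrable_atLeastAtMost')
           (use \<gamma>_cball ne in \<open>auto intro!: continuous_intros \<gamma>_cont continuous_on_compose2[OF R0_cont \<gamma>_cont]\<close>)
      then show ?thesis
        using hi by (simp add: set_borel_integral_eq_integral(2) integral_unique)
    qed
    finally have "half_laplace G w = R0 (1 / w) / w"
      using w0 by simp
    then show ?thesis using w0 by (simp add: R0_def)
  qed
  with G_type that show ?thesis by blast
qed

text \<open>
  The affine part is the transform of \<open>b0 + b1 * t\<close>, and the rest has a double zero at the origin.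
\<close>

lemma laplace_inversion_second_order:
  fixes f :: "complex \<Rightarrow> complex"
  assumes \<eta>: "1 < \<eta>" and hol: "f holomorphic_on Omega \<eta>"
    and bound: "\<And>z. z \<in> Omega \<eta> \<Longrightarrow> norm (f z - (b0 + b1 * z)) \<le> K * norm z ^ 2"
  obtains H where "exp_type (norm b0 + norm b1 + K) \<eta> H"
    "\<And>w. \<eta> < Re w \<Longrightarrow> w * half_laplace H w = f (1 / w)"
proof -
  have "(\<lambda>z. f z - (b0 + b1 * z)) holomorphic_on Omega \<eta>"
    by (intro holomorphic_intros hol)
  then obtain G where G: "exp_type K \<eta> G"
    "\<And>w. \<eta> < Re w \<Longrightarrow> w * half_laplace G w = f (1 / w) - (b0 + b1 * (1 / w))"
    using laplace_inversion_on_circle[OF \<eta> _ bound] by blast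
  define P where "P = (\<lambda>t. b0 + b1 * complex_of_real t)"
  have P: "exp_type (norm b0 + norm b1) \<eta> P"
    unfolding exp_type_def
  proof (intro conjI allI impI)
    show "continuous_on {0..} P"
      unfolding P_def by (intro continuous_intros)
    fix t :: real assume t: "0 \<le> t"
    have "t \<le> \<eta> * t" using \<eta> t by (simp add: mult_le_cancel_right1)
    then have e: "1 \<le> exp (\<eta> * t)" "t \<le> exp (\<eta> * t)"
      using exp_ge_add_one_self[of "\<eta> * t"] t by linarith+
    have "norm (P t) \<le> norm b0 + norm b1 * t"
      using norm_triangle_ineq[of b0 "b1 * of_real t"] t by (simp add: P_def norm_mult)
    also have "\<dots> \<le> norm b0 * exp (\<eta> * t) + norm b1 * exp (\<eta> * t)"
      using e mult_left_mono[OF e(1) norm_ge_zero[of b0]] by (intro add_mono mult_left_mono) auto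
    finally show "norm (P t) \<le> (norm b0 + norm b1) * exp (\<eta> * t)"
      by (simp add: algebra_simps)
  qed
  have "exp_type (norm b0 + norm b1 + K) \<eta> (\<lambda>t. P t + G t)"
    unfolding exp_type_def
  proof (intro conjI allI impI)
    show "continuous_on {0..} (\<lambda>t. P t + G t)"
      using P G by (intro continuous_intros) (auto simp: exp_type_def)
    fix t :: real assume "0 \<le> t"
    then have "norm (P t) \<le> (norm b0 + norm b1) * exp (\<eta> * t)" "norm (G t) \<le> K * exp (\<eta> * t)"
      using P G by (auto simp: exp_type_def)
    then show "norm (P t + G t) \<le> (norm b0 + norm b1 + K) * exp (\<eta> * t)"
      using norm_triangle_ineq[of "P t" "G t"] by (simp add: algebra_simps)
  qed
  moreover have "w * half_laplace (\<lambda>t. P t + G t) w = f (1 / w)" if w: "\<eta> < Re w" for w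
  proof -
    have "w * half_laplace (\<lambda>t. P t + G t) w = w * half_laplace P w + w * half_laplace G w"
      by (simp only: half_laplace_add[OF P G(1) w] distrib_left)
    also have "w * half_laplace P w = b0 + b1 / w"
      using half_laplace_affine[OF _ w P[unfolded P_def]] \<eta> by (simp add: P_def)
    finally show ?thesis by (simp add: G(2)[OF w])
  qed
  ultimately show ?thesis using that by blast
qed

lemma D_class_expansion:
  assumes f: "f \<in> D_class M" and \<eta>: "1 < \<eta>" and M: "\<And>n. 0 < M n"
  obtains C b where "1 \<le> C" "\<And>n z. z \<in> Omega \<eta> \<Longrightarrow>
    norm (f z - (\<Sum>k<n. b k * z ^ k)) \<le> C ^ (n + 1) * M n * norm z ^ n"
proof -
  obtain c C where C: "\<And>n z. z \<in> Omega \<eta> \<Longrightarrow>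
      norm (f z - (\<Sum>k<n. c k / fact k * z ^ k)) \<le> C ^ (n + 1) * M n * norm z ^ n" "0 < C"
    using f \<eta> unfolding D_class_def by blast
  have "norm (f z - (\<Sum>k<n. c k / fact k * z ^ k)) \<le> (max C 1) ^ (n + 1) * M n * norm z ^ n"
    if z: "z \<in> Omega \<eta>" for n z
  proof -
    have "C ^ (n + 1) * M n * norm z ^ n \<le> (max C 1) ^ (n + 1) * M n * norm z ^ n"
      using C(2) M[of n] by (intro mult_right_mono power_mono) auto
    with C(1)[OF z, of n] show ?thesis by linarith
  qed
  then show ?thesis using that[of "max C 1" "\<lambda>k. c k / fact k"] by auto
qed

text \<open>
  \<open>H k\<close> is the inverse transform of the \<open>k\<close>-th shifted function. Estimating \<open>H k\<close> involves
  \<open>M k\<close>, \<open>M (k + 1)\<close> and \<open>M (k + 2)\<close>, through the expansion to order \<open>k + 2\<close>.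
\<close>

lemma D_class_chain:
  assumes reg: "regular_seq M" and f: "f \<in> D_class M" and \<eta>: "1 < \<eta>"
  obtains H C where "0 < C"
    "\<And>n x. 0 \<le> x \<Longrightarrow> (H n has_vector_derivative H (Suc n) x) (at x within {0..})"
    "\<And>n. exp_type (C ^ (n + 1) * M n) \<eta> (H n)"
    "\<And>w. \<eta> < Re w \<Longrightarrow> w * half_laplace (H 0) w = f (1 / w)"
proof -
  have pos: "0 < M n" for n by (rule regular_seq_pos[OF reg])
  obtain B where B: "1 \<le> B" "\<And>n. M (Suc n) \<le> B ^ Suc n * M n"
    using regular_seq_derivation_closed[OF reg] by blast
  obtain C b where C: "1 \<le> C" and expansion: "\<And>n z. z \<in> Omega \<eta> \<Longrightarrow>
      norm (f z - (\<Sum>k<n. b k * z ^ k)) \<le> C ^ (n + 1) * M n * norm z ^ n"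
    using D_class_expansion[OF f \<eta> pos] that by metis
  define g where "g = (\<lambda>k z. (f z - (\<Sum>j<k. b j * z ^ j)) / z ^ k)"
  have hol_f: "f holomorphic_on Omega \<eta>"
    using f \<eta> by (simp add: D_class_def)
  have hol_g: "g k holomorphic_on Omega \<eta>" for k
    unfolding g_def by (intro holomorphic_intros hol_f) (auto simp: Omega_def)
  have g_Suc: "g k z = b k + z * g (Suc k) z" if "z \<noteq> 0" for k z
    using that by (simp add: g_def field_simps)
  have g_bound: "norm (g k z - (b k + b (Suc k) * z)) \<le> C ^ (k + 3) * M (Suc (Suc k)) * norm z ^ 2"
    if z: "z \<in> Omega \<eta>" for k z
  proof -
    have z0: "z \<noteq> 0" using z by (simp add: Omega_def)
    have "g k z - (b k + b (Suc k) * z) = (f z - (\<Sum>j<Suc (Suc k). b j * z ^ j)) / z ^ k"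
      using z0 by (simp add: g_def field_simps)
    then have "norm (g k z - (b k + b (Suc k) * z)) = norm (f z - (\<Sum>j<Suc (Suc k). b j * z ^ j)) / norm z ^ k"
      by (simp only: norm_divide norm_power)
    also have "\<dots> \<le> (C ^ (Suc (Suc k) + 1) * M (Suc (Suc k)) * norm z ^ Suc (Suc k)) / norm z ^ k"
      by (intro divide_right_mono expansion[OF z]) auto
    also have "\<dots> = C ^ (k + 3) * M (Suc (Suc k)) * norm z ^ 2"
      using z0 by (simp add: power2_eq_square eval_nat_numeral)
    finally show ?thesis .
  qed
  define K where "K = (\<lambda>k. norm (b k) + norm (b (Suc k)) + C ^ (k + 3) * M (Suc (Suc k)))"
  have "\<exists>H. exp_type (K k) \<eta> H \<and> (\<forall>w. \<eta> < Re w \<longrightarrow> w * half_laplace H w = g k (1 / w))" for k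
    using laplace_inversion_second_order[OF \<eta> hol_g g_bound] unfolding K_def by metis
  then obtain H where H: "\<And>k. exp_type (K k) \<eta> (H k)"
    "\<And>k w. \<eta> < Re w \<Longrightarrow> w * half_laplace (H k) w = g k (1 / w)"
    by metis
  have \<eta>0: "0 \<le> \<eta>" using \<eta> by simp
  have primitive: "H k x = b k + integral {0..x} (H (Suc k))" if x: "0 \<le> x" for k x
  proof (rule half_laplace_inject[OF exp_type_mono[OF H(1)] exp_type_primitive(1)[OF H(1) \<eta>0] _ x])
    fix w assume w: "\<eta> + 1 < Re w"
    then have w0: "w \<noteq> 0" and w': "\<eta> < Re w" using \<eta> by auto
    have "w * half_laplace (H k) w = g k (1 / w)"
      by (rule H(2)[OF w'])
    also have "\<dots> = b k + 1 / w * g (Suc k) (1 / w)"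
      by (rule g_Suc) (use w0 in simp)
    also have "\<dots> = b k + 1 / w * (w * half_laplace (H (Suc k)) w)"
      by (simp only: H(2)[OF w'])
    also have "\<dots> = w * half_laplace (\<lambda>t. b k + integral {0..t} (H (Suc k))) w"
      using w0 by (simp add: exp_type_primitive(3)[OF H(1) \<eta>0 w])
    finally show "half_laplace (H k) w = half_laplace (\<lambda>t. b k + integral {0..t} (H (Suc k))) w"
      using w0 by simp
  qed simp
  have deriv: "(H k has_vector_derivative H (Suc k) x) (at x within {0..})" if x: "0 \<le> x" for k x
    by (rule has_vector_derivative_transform[OF _ _ exp_type_primitive(2)[OF H(1) \<eta>0 x]])
       (use x primitive in auto)
  have b_bound: "norm (b k) \<le> C ^ (k + 1) * M k + C ^ (k + 2) * M (Suc k)" for k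
  proof -
    \<comment> \<open>Two consecutive expansions at one fixed point determine \<open>b k\<close> up to the two error
      terms; \<open>norm z < 1\<close> removes the extra power of \<open>z\<close> in the second.\<close>
    define z where "z = complex_of_real (1 / \<eta>)"
    have z: "z \<in> Omega \<eta>" "z \<noteq> 0" "norm z \<le> 1"
      using \<eta> by (auto simp: z_def Omega_def norm_divide)
    have "b k * z ^ k = (f z - (\<Sum>j<k. b j * z ^ j)) - (f z - (\<Sum>j<Suc k. b j * z ^ j))"
      by simp
    then have "norm (b k * z ^ k) \<le> norm (f z - (\<Sum>j<k. b j * z ^ j)) + norm (f z - (\<Sum>j<Suc k. b j * z ^ j))"
      by (metis norm_triangle_ineq4)
    also have "\<dots> \<le> C ^ (k + 1) * M k * norm z ^ k + C ^ (Suc k + 1) * M (Suc k) * norm z ^ Suc k"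
      by (intro add_mono expansion z)
    also have "C ^ (Suc k + 1) * M (Suc k) * norm z ^ Suc k \<le> C ^ (k + 2) * M (Suc k) * norm z ^ k"
      using z C pos[of "Suc k"] by (simp add: mult_le_cancel_left1 mult_le_cancel_right1)
    finally have "norm (b k) * norm z ^ k \<le> (C ^ (k + 1) * M k + C ^ (k + 2) * M (Suc k)) * norm z ^ k"
      by (simp add: norm_mult norm_power algebra_simps)
    then show ?thesis using z by simp
  qed
  \<comment> \<open>\<open>K k\<close> is a sum of five terms; each is at most \<open>C ^ i * B ^ j * M k\<close> with
    \<open>i\<close> and \<open>j\<close> bounded by \<open>3 * (k + 1)\<close>.\<close>
  define C' where "C' = 5 * (C ^ 3 * B ^ 3)"
  have C': "0 < C'" using C B by (simp add: C'_def)
  have K_bound: "K k \<le> C' ^ (k + 1) * M k" for k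
  proof -
    define D where "D = (C ^ 3 * B ^ 3) ^ (k + 1)"
    have D: "D = C ^ (3 * (k + 1)) * B ^ (3 * (k + 1))"
      by (simp only: D_def power_mult_distrib power_mult)
    have CB: "C ^ i * B ^ j \<le> D" if "i \<le> 3 * (k + 1)" "j \<le> 3 * (k + 1)" for i j
      unfolding D using that C B by (intro mult_mono power_increasing) auto
    have "C ^ (k + 1) * M k = (C ^ (k + 1) * B ^ 0) * M k" by simp
    also have "\<dots> \<le> D * M k"
      using pos[of k] by (intro mult_right_mono CB) auto
    finally have 1: "C ^ (k + 1) * M k \<le> D * M k" .
    have "C ^ (k + 2) * M (Suc k) \<le> C ^ (k + 2) * (B ^ Suc k * M k)"
      using C B by (intro mult_left_mono) auto
    also have "\<dots> = (C ^ (k + 2) * B ^ Suc k) * M k" by simp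
    also have "\<dots> \<le> D * M k"
      using pos[of k] by (intro mult_right_mono CB) auto
    finally have 2: "C ^ (k + 2) * M (Suc k) \<le> D * M k" .
    have "C ^ (k + 3) * M (Suc (Suc k)) \<le> C ^ (k + 3) * (B ^ Suc (Suc k) * M (Suc k))"
      using C B(2)[of "Suc k"] by (intro mult_left_mono) auto
    also have "\<dots> \<le> C ^ (k + 3) * (B ^ Suc (Suc k) * (B ^ Suc k * M k))"
      using C B(1) B(2)[of k] by (intro mult_left_mono) auto
    also have "\<dots> = (C ^ (k + 3) * B ^ (Suc (Suc k) + Suc k)) * M k"
      unfolding power_add[of B] by simp
    also have "\<dots> \<le> D * M k"
      using pos[of k] by (intro mult_right_mono CB) auto
    finally have 3: "C ^ (k + 3) * M (Suc (Suc k)) \<le> D * M k" .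
    have "K k \<le> 5 * (D * M k)"
      using b_bound[of k] b_bound[of "Suc k"] 1 2 3 unfolding K_def
      by (simp add: numeral_3_eq_3 numeral_2_eq_2)
    also have "\<dots> = 5 ^ 1 * (D * M k)" by simp
    also have "\<dots> \<le> 5 ^ (k + 1) * (D * M k)"
      using D_def C B pos[of k] by (intro mult_right_mono power_increasing) auto
    also have "\<dots> = C' ^ (k + 1) * M k"
      unfolding C'_def D_def power_mult_distrib[of 5] by simp
    finally show ?thesis .
  qed
  have "exp_type (C' ^ (k + 1) * M k) \<eta> (H k)" for k
  proof -
    have "K k * exp (\<eta> * t) \<le> C' ^ (k + 1) * M k * exp (\<eta> * t)" for t
      using K_bound[of k] by (intro mult_right_mono) auto
    with H(1)[of k] show ?thesis
      unfolding exp_type_def by (meson order_trans)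
  qed
  moreover have "w * half_laplace (H 0) w = f (1 / w)" if "\<eta> < Re w" for w
    using H(2)[OF that, of 0] by (simp add: g_def)
  ultimately show ?thesis using that C' deriv by blast
qed

text \<open>
  Inversion at one rate \<open>\<eta>\<close> gives bounds at that rate only. The inverse transforms for different
  rates agree on a common half-plane, hence are equal by uniqueness, so a single function, here the
  one for \<open>\<eta> = 2\<close>, satisfies the bounds for all of them.
\<close>

lemma D_class_subset_laplace_image:
  assumes reg: "regular_seq M" and f: "f \<in> D_class M"
  shows "\<exists>F\<in>A_class M. laplace F = f"
proof -
  have pos: "0 < M n" for n by (rule regular_seq_pos[OF reg])
  obtain H2 C2 where H2: "0 < C2"
    "\<And>n x. 0 \<le> x \<Longrightarrow> (H2 n has_vector_derivative H2 (Suc n) x) (at x within {0..})"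
    "\<And>n. exp_type (C2 ^ (n + 1) * M n) 2 (H2 n)"
    "\<And>w. 2 < Re w \<Longrightarrow> w * half_laplace (H2 0) w = f (1 / w)"
    using D_class_chain[OF reg f, of 2] one_less_numeral_iff semiring_norm(76) that by metis
  define F where "F = (\<lambda>x. if x < 0 then 0 else H2 0 x)"
  have agree: "\<exists>H C. 0 < C \<and> (\<forall>n. exp_type (C ^ (n + 1) * M n) \<eta> (H n))
      \<and> (\<forall>n. \<forall>x\<ge>0. H n x = H2 n x) \<and> (\<forall>w. \<eta> < Re w \<longrightarrow> w * half_laplace (H 0) w = f (1 / w))"
    if \<eta>: "1 < \<eta>" for \<eta>
  proof -
    obtain H C where H: "0 < C"
      "\<And>n x. 0 \<le> x \<Longrightarrow> (H n has_vector_derivative H (Suc n) x) (at x within {0..})"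
      "\<And>n. exp_type (C ^ (n + 1) * M n) \<eta> (H n)"
      "\<And>w. \<eta> < Re w \<Longrightarrow> w * half_laplace (H 0) w = f (1 / w)"
      using D_class_chain[OF reg f \<eta>] that by metis
    have eq0: "H 0 x = H2 0 x" if x: "0 \<le> x" for x
    proof (rule half_laplace_inject[OF exp_type_mono[OF H(3)] exp_type_mono[OF H2(3)] _ x])
      fix w assume w: "max \<eta> 2 < Re w"
      then have "w * half_laplace (H 0) w = w * half_laplace (H2 0) w"
        by (simp add: H(4) H2(4))
      moreover have "w \<noteq> 0" using w by auto
      ultimately show "half_laplace (H 0) w = half_laplace (H2 0) w" by simp
    qed auto
    have "H n x = H2 n x" if x: "0 \<le> x" for n x
      using deriv_half_eq_chain(1)[of "H2 0" H, OF _ H(2) x] deriv_half_eq_chain(1)[of "H2 0" H2, OF _ H2(2) x] eq0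
      by simp
    with H show ?thesis by blast
  qed
  have "F \<in> A_class M"
  proof (rule A_classI[where g = H2])
    fix \<eta> :: real assume "1 < \<eta>"
    then obtain H C where "0 < C" "\<And>n. exp_type (C ^ (n + 1) * M n) \<eta> (H n)" "\<And>n x. 0 \<le> x \<Longrightarrow> H n x = H2 n x"
      using agree by blast
    then show "\<exists>C>0. \<forall>n. \<forall>x\<ge>0. norm (H2 n x) \<le> C ^ (n + 1) * M n * exp (\<eta> * x)"
      by (intro exI[of _ C]) (simp add: exp_type_def)
  qed (use H2(2) in \<open>auto simp: F_def\<close>)
  moreover have "laplace F z = f z" for z
  proof (cases "z \<in> Omega_all")
    case True
    then obtain \<eta> where \<eta>: "1 < \<eta>" "\<eta> < Re (1 / z)"
      using dense[of 1 "Re (1 / z)"] by (auto simp: Omega_all_iff)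
    obtain H where H: "\<And>n x. 0 \<le> x \<Longrightarrow> H n x = H2 n x"
      "\<And>w. \<eta> < Re w \<Longrightarrow> w * half_laplace (H 0) w = f (1 / w)"
      using agree[OF \<eta>(1)] by blast
    have "half_laplace F (1 / z) = half_laplace (H 0) (1 / z)"
      using H(1) by (intro half_laplace_cong) (simp add: F_def)
    then show ?thesis
      using H(2)[OF \<eta>(2)] True by (simp add: laplace_eq_half_laplace)
  next
    case False
    then show ?thesis using f by (simp add: laplace_def D_class_def)
  qed
  ultimately show ?thesis by blast
qed

lemma laplace_image_A_class:
  assumes "regular_seq M"
  shows "laplace ` A_class M = D_class M"
  using laplace_in_D_class[OF assms] D_class_subset_laplace_image[OF assms] by blast

section \<open>Direct sums of translates\<close>

lemma laplace_sum_tau: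
  assumes a: "\<And>j. j \<le> N \<Longrightarrow> 0 \<le> a j" and F: "\<And>j. j \<le> N \<Longrightarrow> F j \<in> A_class M"
  shows "laplace (\<lambda>x. \<Sum>j\<le>N. tau (a j) (F j) x) = (\<lambda>z. \<Sum>j\<le>N. exp_mult (a j) (laplace (F j)) z)"
proof
  fix z
  show "laplace (\<lambda>x. \<Sum>j\<le>N. tau (a j) (F j) x) z = (\<Sum>j\<le>N. exp_mult (a j) (laplace (F j)) z)"
  proof (cases "z \<in> Omega_all")
    case True
    then obtain \<eta> where \<eta>: "1 < \<eta>" "\<eta> < Re (1 / z)"
      using dense[of 1 "Re (1 / z)"] by (auto simp: Omega_all_iff)
    have int: "set_integrable lborel {0..} (\<lambda>t. tau (a j) (F j) t * exp (- (of_real t * (1 / z))))" if jN: "j \<le> N" for j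
    proof -
      obtain C where "\<And>n. exp_type (C ^ (n + 1) * M n) \<eta> (deriv_half n (F j))"
        using A_class_exp_type[OF F[OF jN] \<eta>(1)] by auto
      from this[of 0] show ?thesis
        using tau_kernel_integrable[OF a[OF jN] _ \<eta>(2)] by simp
    qed
    have "half_laplace (\<lambda>x. \<Sum>j\<le>N. tau (a j) (F j) x) (1 / z) = (\<Sum>j\<le>N. half_laplace (tau (a j) (F j)) (1 / z))"
      unfolding half_laplace_def set_lebesgue_integral_def sum_distrib_right scaleR_sum_right
      using int by (intro Bochner_Integration.integral_sum) (auto simp: set_integrable_def)
    also have "\<dots> = (\<Sum>j\<le>N. exp (- (of_real (a j) * (1 / z))) * half_laplace (F j) (1 / z))"
      using a by (intro sum.cong refl half_laplace_tau) auto
    finally show ?thesis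
      using True by (simp add: laplace_eq_half_laplace exp_mult_def sum_distrib_left sum_divide_distrib)
  qed (simp add: laplace_def exp_mult_def)
qed

lemma laplace_sum_tau_inject:
  fixes a :: "nat \<Rightarrow> real" and F G :: "nat \<Rightarrow> real \<Rightarrow> complex"
  assumes a0: "0 \<le> a 0" and a: "\<And>i j. i < j \<Longrightarrow> j \<le> N \<Longrightarrow> a i < a j"
    and reg: "regular_seq M" and div: "\<not> summable (\<lambda>n. M n / M (n + 1))"
    and F: "\<And>j. j \<le> N \<Longrightarrow> F j \<in> A_class M" and G: "\<And>j. j \<le> N \<Longrightarrow> G j \<in> A_class M"
    and eq: "(\<lambda>z. \<Sum>j\<le>N. exp_mult (a j) (laplace (F j)) z) = (\<lambda>z. \<Sum>j\<le>N. exp_mult (a j) (laplace (G j)) z)"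
    and j: "j \<le> N"
  shows "F j = G j"
proof -
  define \<Delta> where "\<Delta> = (\<lambda>j x. F j x - G j x)"
  have \<Delta>: "\<Delta> j \<in> A_class M" if "j \<le> N" for j
    unfolding \<Delta>_def by (rule A_class_diff[OF F[OF that] G[OF that] regular_seq_pos[OF reg]])
  have "\<Delta> j = (\<lambda>_. 0)"
  proof (rule A_class_laplace_sum_zero[OF reg div a \<Delta> _ j])
    fix w :: complex assume w: "1 < Re w"
    define z where "z = 1 / w"
    have w0: "w \<noteq> 0" using w by auto
    then have z: "z \<in> Omega_all" "1 / z = w" using w by (auto simp: Omega_all_iff z_def)
    obtain \<eta> where \<eta>: "1 < \<eta>" "\<eta> < Re w"
      using dense[OF w] by blast
    have diff: "half_laplace (\<Delta> j) w = half_laplace (F j) w - half_laplace (G j) w" if jN: "j \<le> N" for j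
    proof -
      obtain C where C: "\<And>n. exp_type (C ^ (n + 1) * M n) \<eta> (deriv_half n (F j))"
        using A_class_exp_type[OF F[OF jN] \<eta>(1)] by auto
      obtain C' where C': "\<And>n. exp_type (C' ^ (n + 1) * M n) \<eta> (deriv_half n (G j))"
        using A_class_exp_type[OF G[OF jN] \<eta>(1)] by auto
      show ?thesis
        unfolding \<Delta>_def using half_laplace_diff[OF C[of 0] C'[of 0] \<eta>(2)] by simp
    qed
    have expand: "(\<Sum>j\<le>N. exp_mult (a j) (laplace (V j)) z)
        = w * (\<Sum>j\<le>N. exp (- (of_real (a j) * w)) * half_laplace (V j) w)" for V
    proof -
      have "exp (- of_real (a j) / z) = exp (- (of_real (a j) * w))" for j
        by (simp add: z_def)
      then show ?thesis
        by (simp add: exp_mult_def laplace_eq_half_laplace z sum_distrib_left mult_ac)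
    qed
    have "w * (\<Sum>j\<le>N. exp (- (of_real (a j) * w)) * half_laplace (F j) w)
        = w * (\<Sum>j\<le>N. exp (- (of_real (a j) * w)) * half_laplace (G j) w)"
      using fun_cong[OF eq, of z] unfolding expand .
    then have "(\<Sum>j\<le>N. exp (- (of_real (a j) * w)) * half_laplace (F j) w)
        = (\<Sum>j\<le>N. exp (- (of_real (a j) * w)) * half_laplace (G j) w)"
      using w0 by simp
    then show "(\<Sum>j\<le>N. exp (- (of_real (a j) * w)) * half_laplace (\<Delta> j) w) = 0"
      by (simp add: diff right_diff_distrib sum_subtractf)
  qed
  then show ?thesis by (simp add: \<Delta>_def fun_eq_iff)
qed

lemma sum_spacesI:
  "\<forall>j\<le>N. v j \<in> V j \<Longrightarrow> (\<lambda>x. \<Sum>j\<le>N. v j x) \<in> sum_spaces N V"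
  unfolding sum_spaces_def by blast

theorem proposition7p2:
  fixes N :: nat and a :: "nat \<Rightarrow> real" and M :: "nat \<Rightarrow> real"
  assumes "0 \<le> a 0"
    and "\<And>i j. i < j \<Longrightarrow> j \<le> N \<Longrightarrow> a i < a j"
    and "regular_seq M"
    and "\<not> summable (\<lambda>n. M n / M (n + 1))"
  shows "sum_is_direct N (\<lambda>j. tau (a j) ` A_class M)
    \<and> sum_is_direct N (\<lambda>j. exp_mult (a j) ` D_class M)
    \<and> bij_betw laplace
        (sum_spaces N (\<lambda>j. tau (a j) ` A_class M))
        (sum_spaces N (\<lambda>j. exp_mult (a j) ` D_class M))"
proof -
  have inject: "F j = G j"
    if "\<forall>j\<le>N. F j \<in> A_class M" "\<forall>j\<le>N. G j \<in> A_class M"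
      "(\<lambda>z. \<Sum>j\<le>N. exp_mult (a j) (laplace (F j)) z) = (\<lambda>z. \<Sum>j\<le>N. exp_mult (a j) (laplace (G j)) z)"
      "j \<le> N" for F G j
    using assms(1,2) that by (intro laplace_sum_tau_inject[OF _ _ assms(3,4)]) auto
  have a: "0 \<le> a j" if "j \<le> N" for j
    using assms(1) assms(2)[of 0 j] that by (cases "j = 0") auto
  have sum_tau: "laplace (\<lambda>x. \<Sum>j\<le>N. tau (a j) (F j) x) = (\<lambda>z. \<Sum>j\<le>N. exp_mult (a j) (laplace (F j)) z)"
    if "\<forall>j\<le>N. F j \<in> A_class M" for F
    using a that by (intro laplace_sum_tau) auto
  note image = laplace_image_A_class[OF assms(3)]
  have tau_family: "\<exists>F. \<forall>j\<le>N. F j \<in> A_class M \<and> v j = tau (a j) (F j)"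
    if "\<forall>j\<le>N. v j \<in> tau (a j) ` A_class M" for v
    using that by (intro choice) blast
  have exp_family: "\<exists>F. \<forall>j\<le>N. F j \<in> A_class M \<and> v j = exp_mult (a j) (laplace (F j))"
    if "\<forall>j\<le>N. v j \<in> exp_mult (a j) ` D_class M" for v
    using that unfolding image[symmetric] by (intro choice) blast
  have direct_A: "sum_is_direct N (\<lambda>j. tau (a j) ` A_class M)"
    unfolding sum_is_direct_def
  proof (intro allI impI)
    fix v w j
    assume *: "(\<forall>j\<le>N. v j \<in> tau (a j) ` A_class M \<and> w j \<in> tau (a j) ` A_class M)
        \<and> (\<lambda>x. \<Sum>j\<le>N. v j x) = (\<lambda>x. \<Sum>j\<le>N. w j x)" and j: "j \<le> N"
    obtain F where F: "\<forall>j\<le>N. F j \<in> A_class M" "\<forall>j\<le>N. v j = tau (a j) (F j)"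
      using tau_family[of v] * by blast
    obtain G where G: "\<forall>j\<le>N. G j \<in> A_class M" "\<forall>j\<le>N. w j = tau (a j) (G j)"
      using tau_family[of w] * by blast
    have "(\<lambda>x. \<Sum>j\<le>N. tau (a j) (F j) x) = (\<lambda>x. \<Sum>j\<le>N. tau (a j) (G j) x)"
      using * F(2) G(2) by simp
    then have "laplace (\<lambda>x. \<Sum>j\<le>N. tau (a j) (F j) x) = laplace (\<lambda>x. \<Sum>j\<le>N. tau (a j) (G j) x)"
      by (rule arg_cong)
    then have "F j = G j"
      unfolding sum_tau[OF F(1)] sum_tau[OF G(1)] by (rule inject[OF F(1) G(1) _ j])
    then show "v j = w j" using F(2) G(2) j by simp
  qed
  have direct_D: "sum_is_direct N (\<lambda>j. exp_mult (a j) ` D_class M)"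
    unfolding sum_is_direct_def
  proof (intro allI impI)
    fix v w j
    assume *: "(\<forall>j\<le>N. v j \<in> exp_mult (a j) ` D_class M \<and> w j \<in> exp_mult (a j) ` D_class M)
        \<and> (\<lambda>x. \<Sum>j\<le>N. v j x) = (\<lambda>x. \<Sum>j\<le>N. w j x)" and j: "j \<le> N"
    obtain F where F: "\<forall>j\<le>N. F j \<in> A_class M" "\<forall>j\<le>N. v j = exp_mult (a j) (laplace (F j))"
      using exp_family[of v] * by blast
    obtain G where G: "\<forall>j\<le>N. G j \<in> A_class M" "\<forall>j\<le>N. w j = exp_mult (a j) (laplace (G j))"
      using exp_family[of w] * by blast
    have "(\<lambda>z. \<Sum>j\<le>N. exp_mult (a j) (laplace (F j)) z) = (\<lambda>z. \<Sum>j\<le>N. exp_mult (a j) (laplace (G j)) z)"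
      using * F(2) G(2) by simp
    then have "F j = G j" by (rule inject[OF F(1) G(1) _ j])
    then show "v j = w j" using F(2) G(2) j by simp
  qed
  have "bij_betw laplace (sum_spaces N (\<lambda>j. tau (a j) ` A_class M)) (sum_spaces N (\<lambda>j. exp_mult (a j) ` D_class M))"
    unfolding bij_betw_def
  proof
    show "inj_on laplace (sum_spaces N (\<lambda>j. tau (a j) ` A_class M))"
    proof (rule inj_onI)
      fix x y
      assume x: "x \<in> sum_spaces N (\<lambda>j. tau (a j) ` A_class M)"
        and y: "y \<in> sum_spaces N (\<lambda>j. tau (a j) ` A_class M)" and eq: "laplace x = laplace y"
      obtain v where v: "\<forall>j\<le>N. v j \<in> tau (a j) ` A_class M" "x = (\<lambda>t. \<Sum>j\<le>N. v j t)"
        using x unfolding sum_spaces_def by blast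
      obtain F where F: "\<forall>j\<le>N. F j \<in> A_class M" "\<forall>j\<le>N. v j = tau (a j) (F j)"
        using tau_family[OF v(1)] by blast
      have xF: "x = (\<lambda>t. \<Sum>j\<le>N. tau (a j) (F j) t)"
        using v(2) F(2) by simp
      obtain w where w: "\<forall>j\<le>N. w j \<in> tau (a j) ` A_class M" "y = (\<lambda>t. \<Sum>j\<le>N. w j t)"
        using y unfolding sum_spaces_def by blast
      obtain G where G: "\<forall>j\<le>N. G j \<in> A_class M" "\<forall>j\<le>N. w j = tau (a j) (G j)"
        using tau_family[OF w(1)] by blast
      have yG: "y = (\<lambda>t. \<Sum>j\<le>N. tau (a j) (G j) t)"
        using w(2) G(2) by simp
      have "F j = G j" if "j \<le> N" for j
        using eq unfolding xF yG sum_tau[OF F(1)] sum_tau[OF G(1)]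
        by (rule inject[OF F(1) G(1) _ that])
      then show "x = y" by (simp add: xF yG)
    qed
    show "laplace ` sum_spaces N (\<lambda>j. tau (a j) ` A_class M) = sum_spaces N (\<lambda>j. exp_mult (a j) ` D_class M)"
    proof (intro equalityI subsetI)
      fix y assume "y \<in> laplace ` sum_spaces N (\<lambda>j. tau (a j) ` A_class M)"
      then obtain v where v: "\<forall>j\<le>N. v j \<in> tau (a j) ` A_class M" "y = laplace (\<lambda>t. \<Sum>j\<le>N. v j t)"
        unfolding sum_spaces_def by blast
      obtain F where F: "\<forall>j\<le>N. F j \<in> A_class M" "\<forall>j\<le>N. v j = tau (a j) (F j)"
        using tau_family[OF v(1)] by blast
      have y: "y = (\<lambda>z. \<Sum>j\<le>N. exp_mult (a j) (laplace (F j)) z)"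
        using v(2) F(2) sum_tau[OF F(1)] by simp
      show "y \<in> sum_spaces N (\<lambda>j. exp_mult (a j) ` D_class M)"
        unfolding y by (rule sum_spacesI) (use F(1) image in blast)
    next
      fix y assume "y \<in> sum_spaces N (\<lambda>j. exp_mult (a j) ` D_class M)"
      then obtain v where v: "\<forall>j\<le>N. v j \<in> exp_mult (a j) ` D_class M" "y = (\<lambda>t. \<Sum>j\<le>N. v j t)"
        unfolding sum_spaces_def by blast
      obtain F where F: "\<forall>j\<le>N. F j \<in> A_class M" "\<forall>j\<le>N. v j = exp_mult (a j) (laplace (F j))"
        using exp_family[OF v(1)] by blast
      have y: "y = laplace (\<lambda>x. \<Sum>j\<le>N. tau (a j) (F j) x)"
        using v(2) F(2) sum_tau[OF F(1)] by simp
      show "y \<in> laplace ` sum_spaces N (\<lambda>j. tau (a j) ` A_class M)"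
        unfolding y by (intro imageI sum_spacesI) (use F(1) in blast)
    qed
  qed
  with direct_A direct_D show ?thesis by blast
qed

end
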